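(* Let $(\mathfrak g,[\cdot,\cdot],\omega)$ be a nonzero symplectically irreducible symplectic Lie algebra. Then: 1. $(\mathfrak g,[\cdot,\cdot])$ is a $2$-step solvable Lie algebra, i.e. $[[\mathfrak g,\mathfrak g],[\mathfrak g,\mathfrak g]]=\{0\}$; 2. $\mathfrak g=[\mathfrak g,\mathfrak g]\oplus[\mathfrak g,\mathfrak g]^\perp$, where $[\mathfrak g,\mathfrak g]$ is a nondegenerate abelian ideal and $[\mathfrak g,\mathfrak g]^\perp$ is a nondegenerate abelian Lie subalgebra; in particular $(\mathfrak g,[\cdot,\cdot])$ is unimodular; 3. $[\mathfrak g,\mathfrak g]$ is a maximal abelian ideal of $(\mathfrak g,[\cdot,\cdot])$ (maximal for inclusion among abelian ideals); 4. if $\pi$ denotes the representation of $[\mathfrak g,\mathfrak g]^\perp$ on $[\mathfrak g,\mathfrak g]$ defined by $\pi(a)(x):=[a,x]$, then $\pi$ is faithful and $\omega(\pi(a)(x),y)=-\omega(x,\pi(a)(y))$ for all $a\in[\mathfrak g,\mathfrak g]^\perp$ and $x,y\in[\mathfrak g,\mathfrak g]$.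
   Context: All Lie algebras are real and finite-dimensional. A symplectic Lie algebra $(\mathfrak g,[\cdot,\cdot],\omega)$ is a Lie algebra with a nondegenerate skew-symmetric bilinear form $\omega$ satisfying $\omega([x,y],z)+\omega([y,z],x)+\omega([z,x],y)=0$ for all $x,y,z\in\mathfrak g$. For a subspace $\mathfrak m\subseteq\mathfrak g$, $\mathfrak m^\perp=\{x\in\mathfrak g:\omega(x,y)=0\ \forall y\in\mathfrak m\}$; $\mathfrak m$ is isotropic if $\mathfrak m\subset\mathfrak m^\perp$ and nondegenerate if $\mathfrak m\cap\mathfrak m^\perp=\{0\}$. A symplectic Lie algebra is symplectically irreducible if it contains no nonzero isotropic ideal. Unimodular means $\mathrm{tr}(\mathrm{ad}_x)=0$ for all $x$. *)

theory Defs
  imports "HOL-Analysis.Analysis"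
begin

text \<open>The Lie algebra is the whole type \<open>'a\<close>; its subalgebras and ideals are sets.\<close>

locale lie_algebra =
  fixes br :: "'a::real_vector \<Rightarrow> 'a \<Rightarrow> 'a"
  assumes finite_dim: "\<exists>B::'a set. finite B \<and> span B = UNIV"
    and bilinear_br: "bilinear br"
    and br_self: "br x x = 0"
    and jacobi: "br x (br y z) + br y (br z x) + br z (br x y) = 0"

locale symplectic_lie_algebra = lie_algebra br
  for br :: "'a::real_vector \<Rightarrow> 'a \<Rightarrow> 'a" +
  fixes \<omega> :: "'a \<Rightarrow> 'a \<Rightarrow> real"
  assumes bilinear_form: "bilinear \<omega>"
    and skew: "\<omega> x y = - \<omega> y x"
    and nondegenerate: "(\<And>y. \<omega> x y = 0) \<Longrightarrow> x = 0"
    and closed: "\<omega> (br x y) z + \<omega> (br y z) x + \<omega> (br z x) y = 0"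

definition bracket_span :: "('a::real_vector \<Rightarrow> 'a \<Rightarrow> 'a) \<Rightarrow> 'a set \<Rightarrow> 'a set \<Rightarrow> 'a set" where
  "bracket_span br M N = span {br x y | x y. x \<in> M \<and> y \<in> N}"

definition lie_subalgebra :: "('a::real_vector \<Rightarrow> 'a \<Rightarrow> 'a) \<Rightarrow> 'a set \<Rightarrow> bool" where
  "lie_subalgebra br H \<longleftrightarrow> subspace H \<and> (\<forall>x\<in>H. \<forall>y\<in>H. br x y \<in> H)"

definition lie_ideal :: "('a::real_vector \<Rightarrow> 'a \<Rightarrow> 'a) \<Rightarrow> 'a set \<Rightarrow> bool" where
  "lie_ideal br I \<longleftrightarrow> subspace I \<and> (\<forall>x. \<forall>y\<in>I. br x y \<in> I)"

definition lie_abelian :: "('a::real_vector \<Rightarrow> 'a \<Rightarrow> 'a) \<Rightarrow> 'a set \<Rightarrow> bool" where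
  "lie_abelian br H \<longleftrightarrow> (\<forall>x\<in>H. \<forall>y\<in>H. br x y = 0)"

definition maximal_abelian_ideal :: "('a::real_vector \<Rightarrow> 'a \<Rightarrow> 'a) \<Rightarrow> 'a set \<Rightarrow> bool" where
  "maximal_abelian_ideal br I \<longleftrightarrow> lie_ideal br I \<and> lie_abelian br I \<and>
     (\<forall>J. lie_ideal br J \<and> lie_abelian br J \<and> I \<subseteq> J \<longrightarrow> J = I)"

definition perp :: "('a::real_vector \<Rightarrow> 'a \<Rightarrow> real) \<Rightarrow> 'a set \<Rightarrow> 'a set" where
  "perp \<omega> M = {x. \<forall>y\<in>M. \<omega> x y = 0}"

definition isotropic :: "('a::real_vector \<Rightarrow> 'a \<Rightarrow> real) \<Rightarrow> 'a set \<Rightarrow> bool" where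
  "isotropic \<omega> M \<longleftrightarrow> M \<subseteq> perp \<omega> M"

definition nondegenerate_on :: "('a::real_vector \<Rightarrow> 'a \<Rightarrow> real) \<Rightarrow> 'a set \<Rightarrow> bool" where
  "nondegenerate_on \<omega> M \<longleftrightarrow> M \<inter> perp \<omega> M = {0}"

definition symplectically_irreducible ::
    "('a::real_vector \<Rightarrow> 'a \<Rightarrow> 'a) \<Rightarrow> ('a \<Rightarrow> 'a \<Rightarrow> real) \<Rightarrow> bool" where
  "symplectically_irreducible br \<omega> \<longleftrightarrow> \<not> (\<exists>I. lie_ideal br I \<and> isotropic \<omega> I \<and> I \<noteq> {0})"

definition is_direct_sum :: "'a::real_vector set \<Rightarrow> 'a set \<Rightarrow> 'a set \<Rightarrow> bool" where
  "is_direct_sum W U V \<longleftrightarrow>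
     subspace U \<and> subspace V \<and> W = {u + v | u v. u \<in> U \<and> v \<in> V} \<and> U \<inter> V = {0}"

text \<open>The library has only the trace of a matrix. In finite dimension the choice of basis is
  irrelevant, see \<open>lin_trace_eq\<close> below.\<close>

definition lin_trace :: "('a::real_vector \<Rightarrow> 'a) \<Rightarrow> real" where
  "lin_trace f = (let B = SOME B. independent B \<and> span B = UNIV
                  in \<Sum>b\<in>B. representation B (f b) b)"

definition unimodular :: "('a::real_vector \<Rightarrow> 'a \<Rightarrow> 'a) \<Rightarrow> bool" where
  "unimodular br \<longleftrightarrow> (\<forall>x. lin_trace (br x) = 0)"

text \<open>Only the values \<open>\<pi> a x\<close> with \<open>a \<in> H\<close> and \<open>x \<in> V\<close> matter, so
  injectivity of \<open>a \<mapsto> \<pi> a\<close> is stated for the restrictions to \<open>V\<close>.\<close>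

definition lie_representation ::
    "('a::real_vector \<Rightarrow> 'a \<Rightarrow> 'a) \<Rightarrow> 'a set \<Rightarrow> 'b::real_vector set \<Rightarrow> ('a \<Rightarrow> 'b \<Rightarrow> 'b) \<Rightarrow> bool" where
  "lie_representation br H V \<pi> \<longleftrightarrow> lie_subalgebra br H \<and> subspace V \<and>
     (\<forall>a\<in>H. \<forall>x\<in>V. \<pi> a x \<in> V) \<and>
     (\<forall>a\<in>H. \<forall>x\<in>V. \<forall>y\<in>V. \<pi> a (x + y) = \<pi> a x + \<pi> a y) \<and>
     (\<forall>a\<in>H. \<forall>x\<in>V. \<forall>c. \<pi> a (c *\<^sub>R x) = c *\<^sub>R \<pi> a x) \<and>
     (\<forall>a\<in>H. \<forall>b\<in>H. \<forall>x\<in>V. \<pi> (a + b) x = \<pi> a x + \<pi> b x) \<and>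
     (\<forall>a\<in>H. \<forall>x\<in>V. \<forall>c. \<pi> (c *\<^sub>R a) x = c *\<^sub>R \<pi> a x) \<and>
     (\<forall>a\<in>H. \<forall>b\<in>H. \<forall>x\<in>V. \<pi> (br a b) x = \<pi> a (\<pi> b x) - \<pi> b (\<pi> a x))"

definition faithful_on :: "'a set \<Rightarrow> 'b set \<Rightarrow> ('a \<Rightarrow> 'b \<Rightarrow> 'b) \<Rightarrow> bool" where
  "faithful_on H V \<pi> \<longleftrightarrow> inj_on (\<lambda>a. restrict (\<pi> a) V) H"

lemma sum_representation_basis_indep:
  fixes f :: "'a::real_vector \<Rightarrow> 'a"
  assumes f: "linear f"
    and B: "finite B" "independent B" "span B = UNIV"
    and C: "finite C" "independent C" "span C = UNIV"
  shows "(\<Sum>b\<in>B. representation B (f b) b) = (\<Sum>c\<in>C. representation C (f c) c)"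
proof -
  have expB: "(\<Sum>b\<in>B. representation B v b *\<^sub>R b) = v" for v
    using real_vector.sum_representation_eq[of B v B] B by auto
  have expC: "(\<Sum>c\<in>C. representation C v c *\<^sub>R c) = v" for v
    using real_vector.sum_representation_eq[of C v C] C by auto
  have repB: "representation B (\<Sum>i\<in>I. r i *\<^sub>R v i) w = (\<Sum>i\<in>I. r i * representation B (v i) w)"
    for I :: "'a set" and r v w
    using B by (simp add: real_vector.representation_sum real_vector.representation_scale)
  have repC: "representation C (\<Sum>i\<in>I. r i *\<^sub>R v i) w = (\<Sum>i\<in>I. r i * representation C (v i) w)"
    for I :: "'a set" and r v w
    using C by (simp add: real_vector.representation_sum real_vector.representation_scale)
  have "(\<Sum>b\<in>B. representation B (f b) b)
      = (\<Sum>b\<in>B. \<Sum>c\<in>C. representation C (f b) c * representation B c b)"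
    by (subst (1) expC[symmetric]) (simp add: repB)
  also have "\<dots> = (\<Sum>c\<in>C. \<Sum>b\<in>B. representation B c b * representation C (f b) c)"
    by (subst sum.swap) (simp add: mult.commute)
  also have "\<dots> = (\<Sum>c\<in>C. representation C (f (\<Sum>b\<in>B. representation B c b *\<^sub>R b)) c)"
    using f by (simp add: linear_sum linear_cmul repC)
  also have "\<dots> = (\<Sum>c\<in>C. representation C (f c) c)"
    by (simp add: expB)
  finally show ?thesis .
qed

lemma lin_trace_eq:
  fixes f :: "'a::real_vector \<Rightarrow> 'a"
  assumes "linear f" "finite B" "independent B" "span B = UNIV"
  shows "lin_trace f = (\<Sum>b\<in>B. representation B (f b) b)"
proof -
  define C where "C = (SOME C::'a set. independent C \<and> span C = UNIV)"
  have C: "independent C \<and> span C = UNIV"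
    unfolding C_def by (rule someI[of _ B]) (use assms in auto)
  moreover have "finite C"
    using C assms real_vector.independent_span_bound[of B C] by auto
  ultimately show ?thesis
    using sum_representation_basis_indep[of f C B] assms
    unfolding lin_trace_def C_def[symmetric] Let_def by auto
qed

end

theory Submission
  imports Defs "HOL-Computational_Algebra.Fundamental_Theorem_Algebra"
begin

text \<open>
Let \<open>g\<close> be the Lie algebra and \<open>\<omega>\<close> its form. Two facts about ideals carry the proof.

First, if \<open>I\<close> is an abelian ideal, then closedness of \<open>\<omega>\<close> makes \<open>I \<inter> I\<^sup>\<bottom>\<close> an ideal. It is
isotropic, so irreducibility forces every abelian ideal to be nondegenerate
(\<open>abelian_ideal_nondegenerate\<close>). A line in the center is an isotropic ideal as well, so the center
is trivial (\<open>center_trivial\<close>).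

Second, a minimal ideal \<open>m\<close> of any symplectic Lie algebra is abelian (\<open>minimal_ideal_abelian\<close>).
Otherwise \<open>m = [m,m]\<close>, and the form \<open>K(x,y) = tr (ad x \<circ> ad y)\<close> on \<open>m\<close> is nondegenerate or zero.
If it is nondegenerate, every derivation of \<open>m\<close> is inner, \<open>g\<close> is the sum of \<open>m\<close> and its
centralizer, these are \<open>\<omega>\<close>-orthogonal, and hence \<open>\<omega>\<close> is nondegenerate on \<open>m\<close>. Write
\<open>\<omega>(x,y) = K(D x, y)\<close>; closedness says that \<open>D\<close> is a derivation, thus \<open>D = ad u\<close>, so \<open>D u = 0\<close> and
\<open>\<omega>(u,\<cdot>) = 0\<close>, which gives \<open>u = 0\<close>, \<open>D = 0\<close> and \<open>\<omega> = 0\<close> on \<open>m\<close>. If \<open>K = 0\<close>, all \<open>ad y\<close> with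
\<open>y \<in> m\<close> are nilpotent on \<open>m\<close> (the core of Cartan's criterion,
\<open>ad_nilpotent_if_perfect_and_form_zero\<close>), and Engel's theorem yields a nonzero center of \<open>m\<close>, which
is all of \<open>m\<close> by minimality.

Nilpotency of an operator \<open>X\<close> is always obtained in the same way. Let \<open>T\<close> be the operator that
multiplies each generalized eigenspace of \<open>X\<close> by the conjugate of the eigenvalue. It commutes with
whatever commutes with \<open>X\<close>, it is a derivation whenever \<open>X\<close> is one, and \<open>tr (X \<circ> T)\<close> is the sum of
all \<open>|\<lambda>|\<^sup>2\<close>; so \<open>tr (X \<circ> T) = 0\<close> suffices (\<open>conjugate_part_real\<close>). If \<open>X\<close> comes from a sum of
commutators \<open>[a,b]\<close>, then \<open>tr ([a,b] \<circ> T) = tr (a \<circ> [b,T])\<close> reduces this to a property of \<open>[b,T]\<close>.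

Now let \<open>I\<close> be a maximal abelian ideal. Then \<open>g = I \<oplus> I\<^sup>\<bottom>\<close>, where \<open>I\<^sup>\<bottom>\<close> is a subalgebra that acts on
\<open>I\<close> by \<open>\<omega>\<close>-skew maps, and every \<open>I\<^sup>\<bottom>\<close>-invariant subspace of \<open>I\<close> is an abelian ideal of \<open>g\<close> and
therefore nondegenerate. The action is faithful: its kernel is an ideal of \<open>g\<close>, and a minimal ideal
inside it would be abelian and could be added to \<open>I\<close>. If \<open>I\<^sup>\<bottom>\<close> were not abelian, it would have a
minimal ideal \<open>m \<subseteq> [I\<^sup>\<bottom>,I\<^sup>\<bottom>]\<close>; \<open>m\<close> is abelian and acts on \<open>I\<close> by nilpotent maps. If \<open>[m,I]\<close> is not
zero, it contains by Engel a nonzero vector killed by \<open>m\<close>, and skewness makes this vector orthogonal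
to \<open>[m,I]\<close>, contrary to nondegeneracy. So \<open>m\<close> acts trivially, contrary to faithfulness. Thus
\<open>[g,g] = [I\<^sup>\<bottom>,I] \<subseteq> I\<close>, and the orthogonal complement of \<open>[g,g]\<close> in \<open>I\<close> is central, hence zero:
\<open>[g,g] = I\<close>. Unimodularity holds because \<open>ad\<close> of a commutator is traceless and \<open>ad h\<close> is
\<open>\<omega>\<close>-skew on \<open>g\<close> for \<open>h \<in> I\<^sup>\<bottom>\<close>.
\<close>

section \<open>Endomorphisms of a subspace and their traces\<close>

text \<open>Traces are needed over the reals and over a complexification. The scalar multiplication of the
latter is not an instance of a type class, which is why the development is relative to a locale.\<close>

locale trace_space = vector_space scale for scale :: "'a::field \<Rightarrow> 'b::ab_group_add \<Rightarrow> 'b" (infixr \<open>\<cdot>\<close> 75)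
begin

definition basis_of :: "'b set \<Rightarrow> 'b set \<Rightarrow> bool" where
  "basis_of W B \<longleftrightarrow> finite B \<and> independent B \<and> span B = W"

text \<open>Most operators below are meaningful, or linear, on a subspace only, so linearity is
  relative to that subspace.\<close>

definition endo_on :: "'b set \<Rightarrow> ('b \<Rightarrow> 'b) \<Rightarrow> bool" where
  "endo_on W f \<longleftrightarrow> (\<forall>x\<in>W. f x \<in> W) \<and> (\<forall>x\<in>W. \<forall>y\<in>W. f (x + y) = f x + f y) \<and>
     (\<forall>c. \<forall>x\<in>W. f (c \<cdot> x) = c \<cdot> f x)"

definition trace_on :: "'b set \<Rightarrow> ('b \<Rightarrow> 'b) \<Rightarrow> 'a" where
  "trace_on W f = (let B = SOME B. basis_of W B in \<Sum>b\<in>B. representation B (f b) b)"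

lemma endo_onI:
  assumes "\<And>x. x \<in> W \<Longrightarrow> f x \<in> W" "\<And>x y. x \<in> W \<Longrightarrow> y \<in> W \<Longrightarrow> f (x + y) = f x + f y"
    "\<And>c x. x \<in> W \<Longrightarrow> f (c \<cdot> x) = c \<cdot> f x"
  shows "endo_on W f"
  using assms by (auto simp: endo_on_def)

lemma endo_on_mem: "endo_on W f \<Longrightarrow> x \<in> W \<Longrightarrow> f x \<in> W"
  and endo_on_add: "endo_on W f \<Longrightarrow> x \<in> W \<Longrightarrow> y \<in> W \<Longrightarrow> f (x + y) = f x + f y"
  and endo_on_scale: "endo_on W f \<Longrightarrow> x \<in> W \<Longrightarrow> f (c \<cdot> x) = c \<cdot> f x"
  by (auto simp: endo_on_def)

lemma endo_on_zero: "endo_on W f \<Longrightarrow> subspace W \<Longrightarrow> f 0 = 0"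
  using endo_on_scale[of W f 0 0] by (simp add: subspace_0)

lemma endo_on_diff:
  assumes "endo_on W f" "subspace W" "x \<in> W" "y \<in> W"
  shows "f (x - y) = f x - f y"
proof -
  have "f (x + (-1) \<cdot> y) = f x + (-1) \<cdot> f y"
    using assms by (simp only: endo_on_add endo_on_scale subspace_scale)
  then show ?thesis by simp
qed

lemma endo_on_sum:
  assumes "endo_on W f" "subspace W" "\<And>i. i \<in> I \<Longrightarrow> g i \<in> W"
  shows "f (\<Sum>i\<in>I. g i) = (\<Sum>i\<in>I. f (g i))"
  using assms(3)
proof (induction I rule: infinite_finite_induct)
  case (insert i I)
  then show ?case using assms(1,2) by (simp add: endo_on_add[of W f] subspace_sum)
qed (simp_all add: endo_on_zero[OF assms(1,2)])

lemma endo_on_comp: "endo_on W f \<Longrightarrow> endo_on W g \<Longrightarrow> endo_on W (\<lambda>x. f (g x))"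
  by (auto simp: endo_on_def)

lemma endo_on_diff_fun:
  "endo_on W f \<Longrightarrow> endo_on W g \<Longrightarrow> subspace W \<Longrightarrow> endo_on W (\<lambda>x. f x - g x)"
  by (auto simp: endo_on_def subspace_diff scale_right_diff_distrib)

lemma endo_on_funpow: "endo_on W f \<Longrightarrow> endo_on W (f ^^ n)"
  by (induction n) (auto simp: endo_on_def)

lemma basis_of_exists:
  assumes "subspace W" "W \<subseteq> span F" "finite F"
  shows "\<exists>B. basis_of W B"
proof -
  obtain B where B: "B \<subseteq> W" "independent B" "W \<subseteq> span B"
    by (rule maximal_independent_subset[of W])
  then have "span B = W" using assms(1) by (simp add: span_minimal subset_antisym)
  then show ?thesis
    using B assms independent_span_bound[of F B] unfolding basis_of_def by auto
qed

lemma basis_of_extend: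
  assumes "basis_of U B" "U \<subseteq> W" "subspace W" "basis_of W C0"
  obtains C where "basis_of W C" "B \<subseteq> C"
proof -
  have "B \<subseteq> W" using assms(1,2) span_superset[of B] by (auto simp: basis_of_def)
  then obtain C where C: "B \<subseteq> C" "C \<subseteq> W" "independent C" "W \<subseteq> span C"
    using maximal_independent_subset_extend[of B W] assms(1) unfolding basis_of_def by auto
  then have "span C = W" using assms(3) by (simp add: span_minimal subset_antisym)
  moreover have "finite C"
    using assms(4) C independent_span_bound[of C0 C] by (simp add: basis_of_def)
  ultimately show ?thesis using that C by (simp add: basis_of_def)
qed

lemma basis_of_subspace: "basis_of W B \<Longrightarrow> subspace W"
  using subspace_span by (auto simp: basis_of_def)

lemma basis_of_mem: "basis_of W B \<Longrightarrow> b \<in> B \<Longrightarrow> b \<in> W"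
  using span_base by (auto simp: basis_of_def)

lemma basis_of_expand: "basis_of W B \<Longrightarrow> v \<in> W \<Longrightarrow> (\<Sum>b\<in>B. representation B v b \<cdot> b) = v"
  by (rule sum_representation_eq) (auto simp: basis_of_def)

lemma basis_of_rep_sum:
  assumes "basis_of W B" "\<And>i. i \<in> I \<Longrightarrow> v i \<in> W"
  shows "representation B (\<Sum>i\<in>I. r i \<cdot> v i) w = (\<Sum>i\<in>I. r i * representation B (v i) w)"
proof -
  have B: "independent B" "span B = W" using assms(1) by (auto simp: basis_of_def)
  then have "representation B (\<Sum>i\<in>I. r i \<cdot> v i) w = (\<Sum>i\<in>I. representation B (r i \<cdot> v i) w)"
    using assms(2) span_scale by (subst representation_sum) auto
  also have "\<dots> = (\<Sum>i\<in>I. r i * representation B (v i) w)"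
    using assms(2) B by (intro sum.cong refl) (simp add: representation_scale)
  finally show ?thesis .
qed

lemma endo_on_expand:
  assumes "basis_of W B" "endo_on W f" "v \<in> W"
  shows "f v = (\<Sum>b\<in>B. representation B v b \<cdot> f b)"
proof -
  note W = basis_of_subspace[OF assms(1)] and mem = basis_of_mem[OF assms(1)]
  have "f v = f (\<Sum>b\<in>B. representation B v b \<cdot> b)"
    using assms by (simp add: basis_of_expand)
  also have "\<dots> = (\<Sum>b\<in>B. f (representation B v b \<cdot> b))"
    by (rule endo_on_sum[OF assms(2) W]) (simp add: W mem subspace_scale)
  also have "\<dots> = (\<Sum>b\<in>B. representation B v b \<cdot> f b)"
    by (rule sum.cong) (auto simp: mem endo_on_scale[OF assms(2)])
  finally show ?thesis .
qed

lemma basis_of_rep_endo: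
  assumes "basis_of W B" "basis_of W C" "endo_on W f" "v \<in> W"
  shows "representation B (f v) w = (\<Sum>c\<in>C. representation C v c * representation B (f c) w)"
  unfolding endo_on_expand[OF assms(2,3,4)]
  by (rule basis_of_rep_sum[OF assms(1)]) (use assms basis_of_mem in \<open>auto simp: endo_on_mem\<close>)

lemma endo_on_eqI:
  assumes "basis_of W B" "endo_on W f" "endo_on W g" "\<And>b. b \<in> B \<Longrightarrow> f b = g b" "v \<in> W"
  shows "f v = g v"
  using assms by (simp add: endo_on_expand[of W B])

text \<open>The matrices of \<open>f \<circ> g\<close> with respect to \<open>B\<close> and of \<open>g \<circ> f\<close> with respect to \<open>C\<close> have the
  same diagonal sum. This gives at once the independence of the basis (\<open>g = id\<close>) and the
  symmetry of the trace (\<open>B = C\<close>).\<close>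

lemma diagonal_sum_comm:
  assumes "basis_of W B" "basis_of W C" "endo_on W f" "endo_on W g"
  shows "(\<Sum>b\<in>B. representation B (f (g b)) b) = (\<Sum>c\<in>C. representation C (g (f c)) c)"
proof -
  have "(\<Sum>b\<in>B. representation B (f (g b)) b)
      = (\<Sum>b\<in>B. \<Sum>c\<in>C. representation C (g b) c * representation B (f c) b)"
    by (intro sum.cong refl basis_of_rep_endo[OF assms(1,2,3)])
       (use assms basis_of_mem in \<open>auto simp: endo_on_mem\<close>)
  also have "\<dots> = (\<Sum>c\<in>C. \<Sum>b\<in>B. representation B (f c) b * representation C (g b) c)"
    by (subst sum.swap) (simp add: mult.commute)
  also have "\<dots> = (\<Sum>c\<in>C. representation C (g (f c)) c)"
    by (intro sum.cong refl basis_of_rep_endo[OF assms(2,1,4), symmetric])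
       (use assms basis_of_mem in \<open>auto simp: endo_on_mem\<close>)
  finally show ?thesis .
qed

lemma trace_on_eq:
  assumes "basis_of W B" "endo_on W f"
  shows "trace_on W f = (\<Sum>b\<in>B. representation B (f b) b)"
proof -
  have C: "basis_of W (SOME B. basis_of W B)" using assms(1) by (rule someI)
  have "endo_on W (\<lambda>x. x)" by (simp add: endo_on_def)
  from diagonal_sum_comm[OF C assms(1,2) this] show ?thesis by (simp add: trace_on_def)
qed

lemma trace_on_comm:
  assumes "basis_of W B" "endo_on W f" "endo_on W g"
  shows "trace_on W (\<lambda>x. f (g x)) = trace_on W (\<lambda>x. g (f x))"
  using diagonal_sum_comm[OF assms(1,1,2,3)] assms
  by (simp add: trace_on_eq[OF assms(1)] endo_on_comp)

lemma trace_on_cong: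
  assumes "basis_of W B" "endo_on W f" "\<And>x. x \<in> W \<Longrightarrow> f x = g x"
  shows "trace_on W f = trace_on W g"
proof -
  have g: "g x = f x" if "x \<in> W" for x using assms(3) that by simp
  have "endo_on W g"
  proof (rule endo_onI)
    fix x assume x: "x \<in> W"
    show "g x \<in> W" using endo_on_mem[OF assms(2) x] g[OF x] by simp
    show "g (c \<cdot> x) = c \<cdot> g x" for c
      using endo_on_scale[OF assms(2) x] x basis_of_subspace[OF assms(1)] by (simp add: g subspace_scale)
    show "g (x + y) = g x + g y" if "y \<in> W" for y
      using endo_on_add[OF assms(2) x that] x that basis_of_subspace[OF assms(1)] by (simp add: g subspace_add)
  qed
  then show ?thesis
    using assms(1,2) basis_of_mem[OF assms(1)] by (simp add: trace_on_eq[OF assms(1)] g)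
qed

lemma trace_on_diff:
  assumes "basis_of W B" "endo_on W f" "endo_on W g"
  shows "trace_on W (\<lambda>x. f x - g x) = trace_on W f - trace_on W g"
proof -
  have mem: "f b \<in> span B" "g b \<in> span B" if "b \<in> B" for b
    using assms that basis_of_mem[OF assms(1) that] by (auto simp: basis_of_def endo_on_mem)
  have "independent B" using assms(1) by (simp add: basis_of_def)
  then show ?thesis
    using assms basis_of_subspace[OF assms(1)] mem
    by (simp add: trace_on_eq[OF assms(1)] endo_on_diff_fun representation_diff sum_subtractf)
qed

lemma trace_on_lincomb:
  assumes "basis_of W B" "endo_on W f" "endo_on W g"
  shows "trace_on W (\<lambda>x. c \<cdot> f x + g x) = c * trace_on W f + trace_on W g"
proof -
  have mem: "f b \<in> span B" "g b \<in> span B" if "b \<in> B" for b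
    using assms that basis_of_mem[OF assms(1) that] by (auto simp: basis_of_def endo_on_mem)
  have "independent B" using assms(1) by (simp add: basis_of_def)
  moreover have "endo_on W (\<lambda>x. c \<cdot> f x + g x)"
    using assms basis_of_subspace[OF assms(1)]
    by (auto simp: endo_on_def subspace_add subspace_scale scale_right_distrib mult.commute)
  ultimately show ?thesis
    using assms mem
    by (simp add: trace_on_eq[OF assms(1)] representation_add representation_scale span_scale
        sum.distrib sum_distrib_left)
qed

lemma trace_on_zero: "basis_of W B \<Longrightarrow> trace_on W (\<lambda>x. 0) = 0"
  using basis_of_subspace
  by (subst trace_on_eq) (auto simp: endo_on_def subspace_0 representation_zero)

text \<open>Extend a basis of \<open>U\<close> to one of \<open>W\<close>: the added vectors do not contribute.\<close>

lemma trace_on_range: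
  assumes W: "basis_of W C0" and f: "endo_on W f"
    and U: "subspace U" "U \<subseteq> W" "\<And>x. x \<in> W \<Longrightarrow> f x \<in> U"
  shows "trace_on W f = trace_on U f"
proof -
  obtain B where B: "basis_of U B"
    using basis_of_exists[of U C0] W U by (auto simp: basis_of_def)
  obtain C where C: "basis_of W C" "B \<subseteq> C"
    using basis_of_extend[OF B U(2) basis_of_subspace[OF W] W] .
  have rep: "representation C v = representation B v" if "v \<in> U" for v
    using B C that by (intro representation_extend) (auto simp: basis_of_def)
  have mem: "f c \<in> U" if "c \<in> C" for c using U(3) basis_of_mem[OF C(1) that] by blast
  have "endo_on U f" using f U(2,3) by (auto simp: endo_on_def subset_iff)
  have "trace_on W f = (\<Sum>c\<in>C. representation B (f c) c)"
    using C f mem by (simp add: trace_on_eq rep)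
  also have "\<dots> = (\<Sum>c\<in>B. representation B (f c) c)"
    by (rule sum.mono_neutral_right)
       (use C in \<open>auto simp: basis_of_def dest: representation_ne_zero\<close>)
  finally show ?thesis using B \<open>endo_on U f\<close> by (simp add: trace_on_eq)
qed

text \<open>The trace of \<open>f\<close> equals its trace on \<open>f ` W\<close>, where the order of nilpotency is smaller.\<close>

lemma trace_on_nilpotent:
  assumes W: "basis_of W B" and f: "endo_on W f" and n: "\<And>x. x \<in> W \<Longrightarrow> (f ^^ n) x = 0"
  shows "trace_on W f = 0"
  using assms
proof (induction n arbitrary: W B)
  case 0
  then have "trace_on W f = trace_on W (\<lambda>x. 0)" by (intro trace_on_cong) (auto simp: endo_on_def)
  then show ?case using trace_on_zero[OF 0(1)] by simp
next
  case (Suc n)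
  note W = basis_of_subspace[OF Suc.prems(1)]
  have sub: "f ` W \<subseteq> W" using Suc.prems(2) by (auto simp: endo_on_def)
  have U: "subspace (f ` W)"
  proof (rule subspaceI)
    show "0 \<in> f ` W" using endo_on_zero[OF Suc.prems(2) W] subspace_0[OF W] by force
    show "x + y \<in> f ` W" if "x \<in> f ` W" "y \<in> f ` W" for x y
      using that W by (auto simp: endo_on_add[OF Suc.prems(2), symmetric] subspace_add intro!: imageI)
    show "c \<cdot> x \<in> f ` W" if "x \<in> f ` W" for c x
      using that W by (auto simp: endo_on_scale[OF Suc.prems(2), symmetric] subspace_scale intro!: imageI)
  qed
  obtain C where C: "basis_of (f ` W) C"
    using basis_of_exists[OF U, of B] sub Suc.prems(1) unfolding basis_of_def by blast
  have "trace_on W f = trace_on (f ` W) f"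
    by (rule trace_on_range[OF Suc.prems(1,2) U sub]) auto
  also have "\<dots> = 0"
  proof (rule Suc.IH[OF C])
    show "endo_on (f ` W) f" using sub Suc.prems(2) by (auto simp: endo_on_def)
    show "(f ^^ n) x = 0" if "x \<in> f ` W" for x
      using that Suc.prems(3) by (auto simp: funpow_swap1)
  qed
  finally show ?case .
qed

end


global_interpretation rv: trace_space "scaleR :: real \<Rightarrow> 'a \<Rightarrow> 'a::real_vector"
  rewrites "module.span (*\<^sub>R) = span" and "module.dependent (*\<^sub>R) = dependent"
    and "module.subspace (*\<^sub>R) = subspace" and "module.representation (*\<^sub>R) = representation"
  by unfold_locales (simp_all add: span_raw_def dependent_raw_def subspace_raw_def representation_raw_def)

section \<open>Generalized eigenspaces of a complex endomorphism\<close>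

locale complex_endo = trace_space scale
  for scale :: "complex \<Rightarrow> 'b::ab_group_add \<Rightarrow> 'b" (infixr \<open>\<cdot>\<close> 75) +
  fixes V B0 :: "'b set" and X :: "'b \<Rightarrow> 'b"
  assumes basis_V: "basis_of V B0" and endo_X: "endo_on V X"
begin

definition shift :: "complex \<Rightarrow> 'b \<Rightarrow> 'b" where
  "shift \<alpha> v = X v - \<alpha> \<cdot> v"

definition gen_eigen :: "complex \<Rightarrow> 'b set" where
  "gen_eigen \<alpha> = {u \<in> V. \<exists>n. (shift \<alpha> ^^ n) u = 0}"

lemma subspace_V: "subspace V"
  by (rule basis_of_subspace[OF basis_V])

lemma endo_shift: "endo_on V (shift \<alpha>)"
  using endo_X subspace_V unfolding shift_def
  by (auto simp: endo_on_def subspace_diff subspace_scale scale_right_distrib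
      scale_right_diff_distrib mult.commute)

lemmas shift_mem = endo_on_mem[OF endo_shift]
  and shift_pow_mem = endo_on_mem[OF endo_on_funpow[OF endo_shift]]

lemma shift_comm: "v \<in> V \<Longrightarrow> shift \<alpha> (shift \<mu> v) = shift \<mu> (shift \<alpha> v)"
  using endo_on_mem[OF endo_X] subspace_V unfolding shift_def
  by (simp add: endo_on_diff[OF endo_X] endo_on_scale[OF endo_X] subspace_scale
      scale_right_diff_distrib algebra_simps)

lemma shift_pow_comm: "v \<in> V \<Longrightarrow> (shift \<alpha> ^^ n) (shift \<mu> v) = shift \<mu> ((shift \<alpha> ^^ n) v)"
  by (induction n) (auto simp: shift_comm shift_pow_mem)

lemma shift_pow_zero_mono:
  assumes "(shift \<alpha> ^^ n) u = 0" "n \<le> m"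
  shows "(shift \<alpha> ^^ m) u = 0"
proof -
  have "(shift \<alpha> ^^ (m - n)) ((shift \<alpha> ^^ n) u) = 0"
    using assms(1) endo_on_zero[OF endo_on_funpow[OF endo_shift] subspace_V] by simp
  then show ?thesis using assms(2) by (simp flip: funpow_add[unfolded o_def, THEN fun_cong])
qed

lemma subspace_gen_eigen: "subspace (gen_eigen \<alpha>)"
proof (rule subspaceI)
  show "0 \<in> gen_eigen \<alpha>"
    using subspace_0[OF subspace_V] by (auto simp: gen_eigen_def intro: exI[of _ 0])
next
  fix x y assume "x \<in> gen_eigen \<alpha>" "y \<in> gen_eigen \<alpha>"
  then obtain n m where *: "x \<in> V" "y \<in> V" "(shift \<alpha> ^^ n) x = 0" "(shift \<alpha> ^^ m) y = 0"
    by (auto simp: gen_eigen_def)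
  have "(shift \<alpha> ^^ (n + m)) (x + y) = 0"
    using * shift_pow_zero_mono[of n \<alpha> x "n + m"] shift_pow_zero_mono[of m \<alpha> y "n + m"]
    by (simp add: endo_on_add[OF endo_on_funpow[OF endo_shift]])
  then show "x + y \<in> gen_eigen \<alpha>"
    using * subspace_add[OF subspace_V] by (auto simp: gen_eigen_def)
next
  fix c x assume "x \<in> gen_eigen \<alpha>"
  then show "c \<cdot> x \<in> gen_eigen \<alpha>"
    using subspace_scale[OF subspace_V]
    by (auto simp: gen_eigen_def endo_on_scale[OF endo_on_funpow[OF endo_shift]])
qed

lemma gen_eigen_subset: "gen_eigen \<alpha> \<subseteq> V"
  by (auto simp: gen_eigen_def)

lemma shift_gen_eigen: "u \<in> gen_eigen \<alpha> \<Longrightarrow> shift \<mu> u \<in> gen_eigen \<alpha>"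
  using endo_on_zero[OF endo_shift subspace_V]
  unfolding gen_eigen_def by (auto simp: shift_pow_comm shift_mem) metis

lemma shift_pow_gen_eigen: "u \<in> gen_eigen \<alpha> \<Longrightarrow> (shift \<mu> ^^ n) u \<in> gen_eigen \<alpha>"
  by (induction n) (auto simp: shift_gen_eigen)

text \<open>On the generalized eigenspace for \<open>\<mu>\<close>, the operator \<open>shift \<alpha>\<close> is the nonzero scalar \<open>\<mu> - \<alpha>\<close> plus a
nilpotent operator. The induction on the order of nilpotency amounts to summing the geometric series
for its inverse.\<close>

lemma shift_surj_gen_eigen:
  assumes "u \<in> gen_eigen \<mu>" "\<mu> \<noteq> \<alpha>"
  shows "\<exists>w\<in>gen_eigen \<mu>. shift \<alpha> w = u"
proof -
  obtain n where "(shift \<mu> ^^ n) u = 0" using assms by (auto simp: gen_eigen_def)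
  with assms(1) show ?thesis
  proof (induction n arbitrary: u)
    case 0
    then show ?case using endo_on_zero[OF endo_shift subspace_V] by auto
  next
    case (Suc n)
    have "(shift \<mu> ^^ n) (shift \<mu> u) = 0" using Suc.prems(2) by (simp add: funpow_swap1)
    from Suc.IH[OF shift_gen_eigen[OF Suc.prems(1)] this]
    obtain w where w: "w \<in> gen_eigen \<mu>" "shift \<alpha> w = shift \<mu> u" by blast
    define c where "c = 1 / (\<mu> - \<alpha>)"
    have uw: "u - w \<in> gen_eigen \<mu>" using Suc.prems(1) w(1) by (simp add: subspace_diff[OF subspace_gen_eigen])
    have V: "u \<in> V" "w \<in> V" "u - w \<in> V" using Suc.prems(1) w(1) uw gen_eigen_subset by auto
    have "shift \<alpha> (c \<cdot> (u - w)) = c \<cdot> (shift \<alpha> u - shift \<mu> u)"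
      using V w(2) by (simp add: endo_on_scale[OF endo_shift] endo_on_diff[OF endo_shift subspace_V])
    also have "shift \<alpha> u - shift \<mu> u = (\<mu> - \<alpha>) \<cdot> u"
      by (simp add: shift_def scale_left_diff_distrib)
    also have "c \<cdot> (\<mu> - \<alpha>) \<cdot> u = u" using assms(2) by (simp add: c_def)
    finally show ?case using uw subspace_scale[OF subspace_gen_eigen] by blast
  qed
qed

definition gen_eigen_sum :: "'b set" where
  "gen_eigen_sum = span (\<Union>\<alpha>. gen_eigen \<alpha>)"

lemma gen_eigen_sum_subset: "gen_eigen_sum \<subseteq> V"
  unfolding gen_eigen_sum_def using gen_eigen_subset by (intro span_minimal subspace_V) auto

lemma gen_eigen_in_sum: "u \<in> gen_eigen \<alpha> \<Longrightarrow> u \<in> gen_eigen_sum"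
  unfolding gen_eigen_sum_def by (rule span_base) auto

text \<open>Since \<open>shift \<alpha>\<close> is onto on the generalized eigenspaces for other eigenvalues,
\<open>shift \<alpha> v = shift \<alpha> w + e\<close> with \<open>w\<close> in the sum and \<open>e\<close> a generalized eigenvector for \<open>\<alpha>\<close>. Then
\<open>v - w\<close> is a generalized eigenvector for \<open>\<alpha>\<close> too. This step allows one to strip the linear factors
off an annihilating polynomial one by one, without decomposing it into coprime factors.\<close>

lemma gen_eigen_sum_shift_closed:
  assumes v: "v \<in> V" "shift \<alpha> v \<in> gen_eigen_sum"
  shows "v \<in> gen_eigen_sum"
proof -
  let ?P = "{u. \<exists>w\<in>gen_eigen_sum. \<exists>e\<in>gen_eigen \<alpha>. u = shift \<alpha> w + e}"
  have G: "subspace gen_eigen_sum" unfolding gen_eigen_sum_def by (rule subspace_span)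
  have "subspace ?P"
  proof (rule subspaceI)
    have "0 = shift \<alpha> 0 + 0" using endo_on_zero[OF endo_shift subspace_V] by simp
    then show "0 \<in> ?P" using subspace_0[OF G] subspace_0[OF subspace_gen_eigen] by blast
  next
    fix x y assume "x \<in> ?P" "y \<in> ?P"
    then obtain w e w' e' where *: "w \<in> gen_eigen_sum" "e \<in> gen_eigen \<alpha>" "x = shift \<alpha> w + e"
      "w' \<in> gen_eigen_sum" "e' \<in> gen_eigen \<alpha>" "y = shift \<alpha> w' + e'" by blast
    have "x + y = shift \<alpha> (w + w') + (e + e')"
      using * gen_eigen_sum_subset by (subst endo_on_add[OF endo_shift]) (auto simp: algebra_simps)
    then show "x + y \<in> ?P"
      using * subspace_add[OF G] subspace_add[OF subspace_gen_eigen] by blast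
  next
    fix c x assume "x \<in> ?P"
    then obtain w e where *: "w \<in> gen_eigen_sum" "e \<in> gen_eigen \<alpha>" "x = shift \<alpha> w + e" by blast
    have "c \<cdot> x = shift \<alpha> (c \<cdot> w) + c \<cdot> e"
      using * gen_eigen_sum_subset by (subst endo_on_scale[OF endo_shift]) (auto simp: scale_right_distrib)
    then show "c \<cdot> x \<in> ?P"
      using * subspace_scale[OF G] subspace_scale[OF subspace_gen_eigen] by blast
  qed
  moreover have "(\<Union>\<mu>. gen_eigen \<mu>) \<subseteq> ?P"
  proof (rule UN_least)
    fix \<mu>
    show "gen_eigen \<mu> \<subseteq> ?P"
    proof
      fix u assume u: "u \<in> gen_eigen \<mu>"
      show "u \<in> ?P"
      proof (cases "\<mu> = \<alpha>")
        case True
        have "u = shift \<alpha> 0 + u" using endo_on_zero[OF endo_shift subspace_V] by simp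
        then show ?thesis using u True subspace_0[OF G] by blast
      next
        case False
        from shift_surj_gen_eigen[OF u this] obtain w where "w \<in> gen_eigen \<mu>" "u = shift \<alpha> w + 0" by auto
        then show ?thesis using gen_eigen_in_sum subspace_0[OF subspace_gen_eigen] by blast
      qed
    qed
  qed
  ultimately have "gen_eigen_sum \<subseteq> ?P" unfolding gen_eigen_sum_def by (intro span_minimal) auto
  then obtain w e where we: "w \<in> gen_eigen_sum" "e \<in> gen_eigen \<alpha>" "shift \<alpha> v = shift \<alpha> w + e"
    using v(2) by blast
  have wV: "w \<in> V" using we(1) gen_eigen_sum_subset by blast
  have "shift \<alpha> (v - w) = e"
    using we(3) v(1) wV by (simp add: endo_on_diff[OF endo_shift subspace_V])
  then obtain n where "(shift \<alpha> ^^ Suc n) (v - w) = 0"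
    using we(2) by (auto simp: gen_eigen_def funpow_swap1)
  then have "v - w \<in> gen_eigen \<alpha>"
    using v(1) wV subspace_diff[OF subspace_V] unfolding gen_eigen_def by blast
  then have "(v - w) + w \<in> gen_eigen_sum" using we(1) gen_eigen_in_sum subspace_add[OF G] by blast
  then show ?thesis by simp
qed

definition poly_apply :: "complex poly \<Rightarrow> 'b \<Rightarrow> 'b" where
  "poly_apply p v = (\<Sum>i\<le>degree p. coeff p i \<cdot> (X ^^ i) v)"

lemma poly_apply_upto: "degree p \<le> n \<Longrightarrow> poly_apply p v = (\<Sum>i\<le>n. coeff p i \<cdot> (X ^^ i) v)"
  unfolding poly_apply_def by (rule sum.mono_neutral_left) (auto simp: coeff_eq_0)

lemma poly_apply_linear_factor:
  assumes "v \<in> V"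
  shows "poly_apply ([:- a, 1:] * q) v = poly_apply q (shift a v)"
proof -
  define n where "n = degree q"
  note pow = endo_on_funpow[OF endo_X]
  have Xv: "X v \<in> V" using endo_on_mem[OF endo_X assms] .
  have av: "a \<cdot> v \<in> V" using assms subspace_V by (simp add: subspace_scale)
  have eq: "[:- a, 1:] * q = pCons 0 q - smult a q" by simp
  have deg: "degree ([:- a, 1:] * q) \<le> Suc n"
    using degree_mult_le[of "[:- a, 1:]" q] by (simp add: n_def)
  have "poly_apply ([:- a, 1:] * q) v
      = (\<Sum>i\<le>Suc n. coeff (pCons 0 q) i \<cdot> (X ^^ i) v) - (\<Sum>i\<le>Suc n. (a * coeff q i) \<cdot> (X ^^ i) v)"
    unfolding poly_apply_upto[OF deg] by (simp only: eq coeff_diff coeff_smult scale_left_diff_distrib sum_subtractf)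
  also have "(\<Sum>i\<le>Suc n. coeff (pCons 0 q) i \<cdot> (X ^^ i) v) = (\<Sum>i\<le>n. coeff q i \<cdot> (X ^^ i) (X v))"
    by (simp only: sum.atMost_Suc_shift coeff_pCons_0 coeff_pCons_Suc scale_zero_left funpow_swap1 funpow.simps o_apply)
       simp
  also have "(\<Sum>i\<le>Suc n. (a * coeff q i) \<cdot> (X ^^ i) v) = (\<Sum>i\<le>n. coeff q i \<cdot> (X ^^ i) (a \<cdot> v))"
    using assms by (simp add: n_def coeff_eq_0 endo_on_scale[OF pow] mult.commute)
  also have "(\<Sum>i\<le>n. coeff q i \<cdot> (X ^^ i) (X v)) - (\<Sum>i\<le>n. coeff q i \<cdot> (X ^^ i) (a \<cdot> v))
      = poly_apply q (shift a v)"
    using Xv av by (simp add: shift_def poly_apply_def n_def endo_on_diff[OF pow subspace_V]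
        scale_right_diff_distrib sum_subtractf)
  finally show ?thesis .
qed

text \<open>Among the \<open>dim V + 1\<close> vectors \<open>v, X v, X\<^sup>2 v, \<dots>\<close> two coincide or there is a linear relation.\<close>

lemma annihilating_poly_exists:
  assumes v: "v \<in> V"
  shows "\<exists>p. p \<noteq> 0 \<and> poly_apply p v = 0"
proof (cases "inj_on (\<lambda>i. (X ^^ i) v) {..card B0}")
  case True
  let ?f = "\<lambda>i. (X ^^ i) v" and ?n = "card B0"
  have "?f ` {..?n} \<subseteq> span B0"
    using endo_on_mem[OF endo_on_funpow[OF endo_X] v] basis_V by (auto simp: basis_of_def)
  moreover have "card (?f ` {..?n}) > ?n" using True by (simp add: card_image)
  ultimately have "dependent (?f ` {..?n})"
    using independent_span_bound[of B0 "?f ` {..?n}"] basis_V by (auto simp: basis_of_def)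
  then obtain c where c: "\<exists>w\<in>?f ` {..?n}. c w \<noteq> 0" "(\<Sum>w\<in>?f ` {..?n}. c w \<cdot> w) = 0"
    by (auto simp: dependent_finite)
  define p where "p = (\<Sum>i\<le>?n. monom (c (?f i)) i)"
  have coeff: "coeff p i = (if i \<le> ?n then c (?f i) else 0)" for i
    by (simp add: p_def coeff_sum if_distrib cong: if_cong)
  have "p \<noteq> 0" using c(1) coeff by (metis (mono_tags, lifting) atMost_iff coeff_0 imageE)
  moreover have "degree p \<le> ?n" by (rule degree_le) (simp add: coeff)
  then have "poly_apply p v = 0"
    using c(2) by (simp add: poly_apply_upto coeff sum.reindex[OF True])
  ultimately show ?thesis by blast
next
  case False
  then obtain i j where ij: "i < j" "(X ^^ i) v = (X ^^ j) v"
    unfolding inj_on_def by (metis nat_neq_iff)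
  define p :: "complex poly" where "p = monom 1 j - monom 1 i"
  have coeff: "coeff p k = (if k = j then 1 else if k = i then -1 else 0)" for k
    using ij(1) by (simp add: p_def)
  have "p \<noteq> 0" using coeff by (metis coeff_0 zero_neq_one)
  moreover have "degree p \<le> j" by (rule degree_le) (use ij(1) in \<open>simp add: coeff\<close>)
  then have "poly_apply p v = (\<Sum>k\<in>{i, j}. coeff p k \<cdot> (X ^^ k) v)"
    unfolding poly_apply_upto[OF \<open>degree p \<le> j\<close>]
    by (intro sum.mono_neutral_right) (use ij(1) in \<open>auto simp: coeff\<close>)
  then have "poly_apply p v = 0" using ij by (simp add: coeff)
  ultimately show ?thesis by blast
qed

lemma gen_eigen_sum_eq: "gen_eigen_sum = V"
proof -
  have "v \<in> gen_eigen_sum" if "p \<noteq> 0" "v \<in> V" "poly_apply p v = 0" for p v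
    using that
  proof (induction "degree p" arbitrary: p v)
    case 0
    then have "coeff p 0 \<cdot> v = 0" "coeff p 0 \<noteq> 0"
      using leading_coeff_0_iff[of p] by (auto simp: poly_apply_def)
    then show ?case unfolding gen_eigen_sum_def by (simp add: span_zero)
  next
    case (Suc n)
    have "\<not> constant (poly p)" using Suc.hyps(2) by (simp add: constant_degree)
    then obtain a where "poly p a = 0" using fundamental_theorem_of_algebra by blast
    then obtain q where q: "p = [:- a, 1:] * q" by (auto simp: poly_eq_0_iff_dvd dvd_def)
    have q0: "q \<noteq> 0" using q Suc.prems(1) by auto
    then have "degree p = Suc (degree q)" unfolding q by (subst degree_mult_eq) auto
    then have "shift a v \<in> gen_eigen_sum"
      using Suc.hyps q0 Suc.prems poly_apply_linear_factor[OF Suc.prems(2), of a q] shift_mem q by auto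
    then show ?case using gen_eigen_sum_shift_closed Suc.prems(2) by blast
  qed
  then show ?thesis using gen_eigen_sum_subset annihilating_poly_exists by blast
qed

text \<open>By induction on \<open>m + n\<close>, both \<open>shift \<mu> u\<close> and \<open>shift \<alpha> u\<close> vanish, so \<open>u\<close> would be an eigenvector for
two eigenvalues.\<close>

lemma gen_eigen_disjoint:
  assumes "u \<in> gen_eigen \<mu>" "(shift \<alpha> ^^ n) u = 0" "\<mu> \<noteq> \<alpha>"
  shows "u = 0"
proof -
  obtain m where "(shift \<mu> ^^ m) u = 0" using assms by (auto simp: gen_eigen_def)
  with assms(1,2) show ?thesis
  proof (induction "m + n" arbitrary: m n u)
    case 0
    then show ?case by simp
  next
    case (Suc k)
    show ?case
    proof (cases "m = 0 \<or> n = 0")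
      case True
      then show ?thesis using Suc.prems by auto
    next
      case False
      then obtain m' n' where mn: "m = Suc m'" "n = Suc n'" by (metis not0_implies_Suc)
      have uV: "u \<in> V" using Suc.prems(1) gen_eigen_subset by blast
      have z: "shift \<nu> 0 = 0" for \<nu> using endo_on_zero[OF endo_shift subspace_V] .
      have "shift \<mu> u = 0"
      proof (rule Suc.hyps(1)[of m' n])
        show "(shift \<alpha> ^^ n) (shift \<mu> u) = 0" using uV Suc.prems(2) by (simp add: shift_pow_comm z)
        show "(shift \<mu> ^^ m') (shift \<mu> u) = 0" using Suc.prems(3) mn by (simp add: funpow_swap1)
      qed (use Suc mn in \<open>auto simp: shift_gen_eigen\<close>)
      moreover have "shift \<alpha> u = 0"
      proof (rule Suc.hyps(1)[of m n'])
        show "(shift \<mu> ^^ m) (shift \<alpha> u) = 0" using uV Suc.prems(3) by (simp add: shift_pow_comm z)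
        show "(shift \<alpha> ^^ n') (shift \<alpha> u) = 0" using Suc.prems(2) mn by (simp add: funpow_swap1)
      qed (use Suc mn in \<open>auto simp: shift_gen_eigen\<close>)
      ultimately have "(\<mu> - \<alpha>) \<cdot> u = 0" by (simp add: shift_def scale_left_diff_distrib)
      then show ?thesis using assms(3) by simp
    qed
  qed
qed

text \<open>A power of \<open>shift \<alpha>\<close> kills the summand for \<open>\<alpha>\<close> and is injective on the other generalized
eigenspaces, which it preserves.\<close>

lemma gen_eigen_independent:
  assumes "finite \<Lambda>" "\<And>\<mu>. \<mu> \<in> \<Lambda> \<Longrightarrow> w \<mu> \<in> gen_eigen \<mu>" "(\<Sum>\<mu>\<in>\<Lambda>. w \<mu>) = 0" "\<mu> \<in> \<Lambda>"
  shows "w \<mu> = 0"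
  using assms
proof (induction \<Lambda> arbitrary: w \<mu> rule: finite_induct)
  case (insert \<alpha> \<Lambda>)
  obtain n where n: "(shift \<alpha> ^^ n) (w \<alpha>) = 0" using insert.prems(1) by (force simp: gen_eigen_def)
  note pow = endo_on_funpow[OF endo_shift, of n \<alpha>]
  have V: "w \<nu> \<in> V" if "\<nu> \<in> insert \<alpha> \<Lambda>" for \<nu> using insert.prems(1)[OF that] gen_eigen_subset by blast
  have "(shift \<alpha> ^^ n) (\<Sum>\<nu>\<in>insert \<alpha> \<Lambda>. w \<nu>) = (\<Sum>\<nu>\<in>insert \<alpha> \<Lambda>. (shift \<alpha> ^^ n) (w \<nu>))"
    by (rule endo_on_sum[OF pow subspace_V V])
  then have "(\<Sum>\<nu>\<in>\<Lambda>. (shift \<alpha> ^^ n) (w \<nu>)) = 0"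
    using insert n by (simp add: endo_on_zero[OF pow subspace_V])
  then have shifted: "(shift \<alpha> ^^ n) (w \<nu>) = 0" if "\<nu> \<in> \<Lambda>" for \<nu>
    by (intro insert.IH[of "\<lambda>\<nu>. (shift \<alpha> ^^ n) (w \<nu>)", OF _ _ that]
          shift_pow_gen_eigen insert.prems(1)) auto
  have zero: "w \<nu> = 0" if "\<nu> \<in> \<Lambda>" for \<nu>
  proof (rule gen_eigen_disjoint)
    show "w \<nu> \<in> gen_eigen \<nu>" using that by (intro insert.prems(1)) simp
    show "\<nu> \<noteq> \<alpha>" using that insert.hyps by auto
  qed (rule shifted[OF that])
  have "w \<alpha> = (\<Sum>\<nu>\<in>insert \<alpha> \<Lambda>. w \<nu>)"
    using insert.hyps by (simp add: zero)
  then have "w \<alpha> = 0" using insert.prems(2) by simp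
  with zero insert.prems(3) show ?case by auto
qed simp

lemma gen_eigen_basis: "\<exists>B \<mu>. basis_of V B \<and> (\<forall>b\<in>B. b \<in> gen_eigen (\<mu> b))"
proof -
  obtain B where B: "B \<subseteq> (\<Union>\<alpha>. gen_eigen \<alpha>)" "independent B" "(\<Union>\<alpha>. gen_eigen \<alpha>) \<subseteq> span B"
    by (rule maximal_independent_subset)
  have "V \<subseteq> span B"
    using B(3) gen_eigen_sum_eq unfolding gen_eigen_sum_def by (metis span_minimal subspace_span)
  moreover have "B \<subseteq> V" using B(1) gen_eigen_subset by blast
  then have "span B \<subseteq> V" by (rule span_minimal[OF _ subspace_V])
  moreover have "finite B"
    using independent_span_bound[of B0 B] B(2) \<open>B \<subseteq> V\<close> basis_V by (auto simp: basis_of_def)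
  ultimately have "basis_of V B" using B(2) by (auto simp: basis_of_def)
  moreover have "\<exists>\<mu>. \<forall>b\<in>B. b \<in> gen_eigen (\<mu> b)" using B(1) by (intro bchoice) auto
  ultimately show ?thesis by blast
qed

text \<open>The operator is defined on a basis of generalized eigenvectors. Independence of the generalized
eigenspaces is what makes it a scalar on each of them, and not only on the basis vectors that they
contain.\<close>

lemma gen_eigen_scalar_endo:
  "\<exists>T. endo_on V T \<and> (\<forall>\<alpha>. \<forall>u\<in>gen_eigen \<alpha>. T u = \<phi> \<alpha> \<cdot> u)"
proof -
  obtain B \<mu> where B: "basis_of V B" "\<And>b. b \<in> B \<Longrightarrow> b \<in> gen_eigen (\<mu> b)"
    using gen_eigen_basis by blast
  have ind: "independent B" and sp: "span B = V" and fin: "finite B" using B(1) by (auto simp: basis_of_def)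
  define T where "T v = (\<Sum>b\<in>B. representation B v b \<cdot> \<phi> (\<mu> b) \<cdot> b)" for v
  have T: "endo_on V T"
  proof (rule endo_onI)
    show "T x \<in> V" for x
      unfolding T_def using basis_of_mem[OF B(1)] subspace_V
      by (intro subspace_sum subspace_scale) auto
    show "T (x + y) = T x + T y" if "x \<in> V" "y \<in> V" for x y
      using that by (simp add: T_def representation_add ind sp scale_left_distrib distrib_right sum.distrib)
    show "T (c \<cdot> x) = c \<cdot> T x" if "x \<in> V" for c x
      using that by (simp add: T_def representation_scale ind sp scale_sum_right mult.assoc)
  qed
  have "T u = \<phi> \<alpha> \<cdot> u" if u: "u \<in> gen_eigen \<alpha>" for u \<alpha>
  proof -
    define w where "w \<nu> = (\<Sum>b\<in>{b\<in>B. \<mu> b = \<nu>}. representation B u b \<cdot> b)" for \<nu>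
    have uV: "u \<in> V" using u gen_eigen_subset by blast
    have w: "w \<nu> \<in> gen_eigen \<nu>" for \<nu>
      unfolding w_def using B(2) by (intro subspace_sum subspace_scale subspace_gen_eigen) auto
    let ?\<Lambda> = "insert \<alpha> (\<mu> ` B)"
    have "(\<Sum>\<nu>\<in>?\<Lambda>. w \<nu>) = (\<Sum>b\<in>B. representation B u b \<cdot> b)"
      unfolding w_def by (rule sum.group) (use fin in auto)
    also have "\<dots> = u" by (rule basis_of_expand[OF B(1) uV])
    finally have sum_w: "(\<Sum>\<nu>\<in>?\<Lambda>. w \<nu>) = u" .
    have "w \<nu> - (if \<nu> = \<alpha> then u else 0) = 0" if "\<nu> \<in> ?\<Lambda>" for \<nu>
    proof (rule gen_eigen_independent[OF _ _ _ that])
      show "(\<Sum>\<nu>\<in>?\<Lambda>. w \<nu> - (if \<nu> = \<alpha> then u else 0)) = 0"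
        using fin by (simp only: sum_subtractf sum_w) simp
      show "w \<nu> - (if \<nu> = \<alpha> then u else 0) \<in> gen_eigen \<nu>" for \<nu>
        using w u by (auto intro: subspace_diff[OF subspace_gen_eigen])
    qed (use fin in auto)
    then have zero: "w \<nu> = (if \<nu> = \<alpha> then u else 0)" if "\<nu> \<in> ?\<Lambda>" for \<nu> using that by fastforce
    have "T u = (\<Sum>\<nu>\<in>?\<Lambda>. \<Sum>b\<in>{b\<in>B. \<mu> b = \<nu>}. representation B u b \<cdot> \<phi> (\<mu> b) \<cdot> b)"
      unfolding T_def by (rule sum.group[symmetric]) (use fin in auto)
    also have "\<dots> = (\<Sum>\<nu>\<in>?\<Lambda>. \<phi> \<nu> \<cdot> w \<nu>)"
      by (simp only: w_def scale_sum_right) (intro sum.cong refl, auto simp: mult.commute)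
    also have "\<dots> = (\<Sum>\<nu>\<in>?\<Lambda>. if \<nu> = \<alpha> then \<phi> \<alpha> \<cdot> u else 0)"
      by (rule sum.cong) (auto simp: zero)
    also have "\<dots> = \<phi> \<alpha> \<cdot> u" using fin by simp
    finally show ?thesis .
  qed
  then show ?thesis using T by blast
qed

lemma uniform_nilpotency:
  assumes B: "basis_of V B" and f: "endo_on V f" and n: "\<And>b. b \<in> B \<Longrightarrow> \<exists>n. (f ^^ n) b = 0"
  shows "\<exists>n. \<forall>v\<in>V. (f ^^ n) v = 0"
proof -
  obtain k where k: "\<And>b. b \<in> B \<Longrightarrow> (f ^^ k b) b = 0" using n by metis
  define N where "N = Max (insert 0 (k ` B))"
  have fin: "finite B" using B by (simp add: basis_of_def)
  have "(f ^^ N) b = 0" if "b \<in> B" for b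
  proof -
    have "k b \<le> N" unfolding N_def using fin that by (intro Max_ge) auto
    then have "(f ^^ N) b = (f ^^ (N - k b)) ((f ^^ k b) b)"
      by (simp flip: funpow_add[unfolded o_def, THEN fun_cong])
    then show ?thesis using k[OF that] endo_on_zero[OF endo_on_funpow[OF f] subspace_V] by simp
  qed
  then have "(f ^^ N) v = 0" if "v \<in> V" for v
    using endo_on_expand[OF B endo_on_funpow[OF f] that] by (simp add: sum.neutral)
  then show ?thesis by blast
qed

text \<open>On the generalized eigenspace for \<open>\<alpha>\<close>, the product \<open>X \<circ> T\<close> is \<open>|\<alpha>|\<^sup>2\<close> plus a nilpotent operator, so
its trace is the sum of all \<open>|\<alpha>|\<^sup>2\<close>, and vanishes only if \<open>0\<close> is the only eigenvalue.\<close>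

lemma conjugate_part:
  "\<exists>T. endo_on V T \<and> (\<forall>\<alpha>. \<forall>u\<in>gen_eigen \<alpha>. T u = cnj \<alpha> \<cdot> u) \<and>
     (Re (trace_on V (\<lambda>v. X (T v))) = 0 \<longrightarrow> (\<exists>n. \<forall>v\<in>V. (X ^^ n) v = 0))"
proof -
  obtain T where T: "endo_on V T" "\<And>\<alpha> u. u \<in> gen_eigen \<alpha> \<Longrightarrow> T u = cnj \<alpha> \<cdot> u"
    using gen_eigen_scalar_endo[of cnj] by blast
  obtain P where P: "endo_on V P" "\<And>\<alpha> u. u \<in> gen_eigen \<alpha> \<Longrightarrow> P u = (cnj \<alpha> * \<alpha>) \<cdot> u"
    using gen_eigen_scalar_endo[of "\<lambda>\<alpha>. cnj \<alpha> * \<alpha>"] by blast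
  obtain B \<mu> where B: "basis_of V B" "\<And>b. b \<in> B \<Longrightarrow> b \<in> gen_eigen (\<mu> b)"
    using gen_eigen_basis by blast
  have XT: "endo_on V (\<lambda>v. X (T v))" by (rule endo_on_comp[OF endo_X T(1)])
  define Q where "Q v = X (T v) - P v" for v
  have Q: "endo_on V Q" unfolding Q_def by (rule endo_on_diff_fun[OF XT P(1) subspace_V])
  have Q_eigen: "Q u = cnj \<alpha> \<cdot> shift \<alpha> u" if "u \<in> gen_eigen \<alpha>" for u \<alpha>
    using that gen_eigen_subset
    by (simp add: Q_def T(2) P(2) shift_def subset_iff endo_on_scale[OF endo_X] scale_right_diff_distrib)
  have Q_pow: "(Q ^^ n) u = (cnj \<alpha>) ^ n \<cdot> (shift \<alpha> ^^ n) u" if u: "u \<in> gen_eigen \<alpha>" for n u \<alpha>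
  proof (induction n)
    case (Suc n)
    have "(shift \<alpha> ^^ n) u \<in> gen_eigen \<alpha>" by (rule shift_pow_gen_eigen[OF u])
    moreover from this have "(shift \<alpha> ^^ n) u \<in> V" using gen_eigen_subset by blast
    ultimately show ?case
      using Suc by (simp add: endo_on_scale[OF Q] Q_eigen mult.commute)
  qed simp
  have "\<exists>n. \<forall>v\<in>V. (Q ^^ n) v = 0"
  proof (rule uniform_nilpotency[OF B(1) Q])
    fix b assume "b \<in> B"
    with B(2) obtain n where "(shift (\<mu> b) ^^ n) b = 0" by (force simp: gen_eigen_def)
    then show "\<exists>n. (Q ^^ n) b = 0" using Q_pow[OF B(2)[OF \<open>b \<in> B\<close>]] by auto
  qed
  then have "trace_on V Q = 0" using trace_on_nilpotent[OF B(1) Q] by blast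
  then have "trace_on V (\<lambda>v. X (T v)) = trace_on V P"
    unfolding Q_def using trace_on_diff[OF B(1) XT P(1)] by simp
  also have "\<dots> = (\<Sum>b\<in>B. cnj (\<mu> b) * \<mu> b)"
  proof -
    have "representation B (P b) b = cnj (\<mu> b) * \<mu> b" if "b \<in> B" for b
    proof -
      have "P b = (cnj (\<mu> b) * \<mu> b) \<cdot> b" using B(2)[OF that] by (rule P(2))
      moreover have "independent B" using B(1) by (simp add: basis_of_def)
      ultimately show ?thesis
        using that by (simp add: representation_scale[OF _ span_base] representation_basis)
    qed
    then show ?thesis using trace_on_eq[OF B(1) P(1)] by simp
  qed
  finally have trace: "Re (trace_on V (\<lambda>v. X (T v))) = (\<Sum>b\<in>B. (cmod (\<mu> b))\<^sup>2)"
    by (simp add: cmod_power2) (simp add: power2_eq_square)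
  have "\<exists>n. \<forall>v\<in>V. (X ^^ n) v = 0" if "Re (trace_on V (\<lambda>v. X (T v))) = 0"
  proof (rule uniform_nilpotency[OF B(1) endo_X])
    fix b assume b: "b \<in> B"
    have "finite B" using B(1) by (simp add: basis_of_def)
    with that trace b have "\<mu> b = 0" by (simp add: sum_nonneg_eq_0_iff)
    with B(2)[OF b] obtain n where "(shift 0 ^^ n) b = 0" by (auto simp: gen_eigen_def)
    moreover have "shift 0 = X" by (simp add: shift_def fun_eq_iff)
    ultimately show "\<exists>n. (X ^^ n) b = 0" by auto
  qed
  then show ?thesis using T by blast
qed

text \<open>An operator that commutes with \<open>X\<close> preserves the generalized eigenspaces, and \<open>T\<close> is scalar there.\<close>

lemma gen_eigen_commutant:
  assumes f: "endo_on V f" "\<And>x. x \<in> V \<Longrightarrow> f (X x) = X (f x)"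
    and T: "endo_on V T" "\<And>\<alpha> u. u \<in> gen_eigen \<alpha> \<Longrightarrow> T u = \<phi> \<alpha> \<cdot> u"
    and x: "x \<in> V"
  shows "f (T x) = T (f x)"
proof -
  obtain B \<mu> where B: "basis_of V B" "\<And>b. b \<in> B \<Longrightarrow> b \<in> gen_eigen (\<mu> b)"
    using gen_eigen_basis by blast
  have shift: "shift \<alpha> (f u) = f (shift \<alpha> u)" if "u \<in> V" for \<alpha> u
    using that subspace_V
    by (simp add: shift_def f(2) endo_on_mem[OF endo_X] subspace_scale
        endo_on_diff[OF f(1) subspace_V] endo_on_scale[OF f(1)])
  have pow: "(shift \<alpha> ^^ n) (f u) = f ((shift \<alpha> ^^ n) u)" if "u \<in> V" for \<alpha> u n
    using that by (induction n) (auto simp: shift shift_pow_mem)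
  have inv: "f u \<in> gen_eigen \<alpha>" if u: "u \<in> gen_eigen \<alpha>" for u \<alpha>
  proof -
    obtain n where n: "u \<in> V" "(shift \<alpha> ^^ n) u = 0" using u by (auto simp: gen_eigen_def)
    then have "(shift \<alpha> ^^ n) (f u) = 0" using endo_on_zero[OF f(1) subspace_V] by (simp add: pow)
    then show ?thesis using n(1) endo_on_mem[OF f(1)] by (auto simp: gen_eigen_def)
  qed
  show ?thesis
  proof (rule endo_on_eqI[OF B(1) endo_on_comp[OF f(1) T(1)] endo_on_comp[OF T(1) f(1)] _ x])
    fix b assume "b \<in> B"
    note b = B(2)[OF this]
    from b have "b \<in> V" using gen_eigen_subset by blast
    then show "f (T b) = T (f b)" using T(2)[OF b] T(2)[OF inv[OF b]] endo_on_scale[OF f(1)] by simp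
  qed
qed

definition bilinear_on_V :: "('b \<Rightarrow> 'b \<Rightarrow> 'b) \<Rightarrow> bool" where
  "bilinear_on_V \<beta> \<longleftrightarrow> (\<forall>x\<in>V. endo_on V (\<beta> x)) \<and> (\<forall>y\<in>V. endo_on V (\<lambda>x. \<beta> x y))"

text \<open>The Leibniz rule gives
\<open>shift (\<alpha> + \<gamma>) (\<beta> x y) = \<beta> (shift \<alpha> x) y + \<beta> x (shift \<gamma> y)\<close>. Iterated \<open>n + m\<close> times, every term on the
right contains an \<open>n\<close>-th power of the first or an \<open>m\<close>-th power of the second shift.\<close>

lemma gen_eigen_product:
  assumes \<beta>: "bilinear_on_V \<beta>"
    and X: "\<And>x y. x \<in> V \<Longrightarrow> y \<in> V \<Longrightarrow> X (\<beta> x y) = \<beta> (X x) y + \<beta> x (X y)"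
    and u: "u \<in> gen_eigen \<alpha>" and v: "v \<in> gen_eigen \<gamma>"
  shows "\<beta> u v \<in> gen_eigen (\<alpha> + \<gamma>)"
proof -
  have l: "endo_on V (\<lambda>x. \<beta> x y)" and r: "endo_on V (\<beta> y)" if "y \<in> V" for y
    using \<beta> that by (auto simp: bilinear_on_V_def)
  have shift: "shift (\<alpha> + \<gamma>) (\<beta> x y) = \<beta> (shift \<alpha> x) y + \<beta> x (shift \<gamma> y)" if "x \<in> V" "y \<in> V" for x y
    using that subspace_V
    by (simp add: shift_def X endo_on_mem[OF endo_X] subspace_scale scale_left_distrib
        endo_on_diff[OF l subspace_V] endo_on_diff[OF r subspace_V] endo_on_scale[OF l] endo_on_scale[OF r])
  have zero: "shift \<delta> 0 = 0" "\<beta> 0 y = 0" "\<beta> y 0 = 0" "(shift \<delta> ^^ k) 0 = 0" if "y \<in> V" for \<delta> y k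
    using endo_on_zero[OF endo_shift subspace_V] endo_on_zero[OF l[OF that] subspace_V]
      endo_on_zero[OF r[OF that] subspace_V] endo_on_zero[OF endo_on_funpow[OF endo_shift] subspace_V]
    by auto
  obtain n where n: "u \<in> V" "(shift \<alpha> ^^ n) u = 0" using u by (auto simp: gen_eigen_def)
  obtain m where m: "v \<in> V" "(shift \<gamma> ^^ m) v = 0" using v by (auto simp: gen_eigen_def)
  have "(shift (\<alpha> + \<gamma>) ^^ (n + m)) (\<beta> u v) = 0"
    using n m
  proof (induction "n + m" arbitrary: n m u v)
    case 0
    then show ?case by (simp add: zero)
  next
    case (Suc k)
    show ?case
    proof (cases "n = 0 \<or> m = 0")
      case True
      then have "u = 0 \<or> v = 0" using Suc.prems by auto
      then show ?thesis using Suc.prems by (auto simp: zero)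
    next
      case False
      then obtain n' m' where nm: "n = Suc n'" "m = Suc m'" by (metis not0_implies_Suc)
      have "(shift (\<alpha> + \<gamma>) ^^ (n' + m)) (\<beta> (shift \<alpha> u) v) = 0"
        by (rule Suc.hyps(1)) (use Suc nm in \<open>auto simp: shift_mem funpow_swap1\<close>)
      moreover have "(shift (\<alpha> + \<gamma>) ^^ (n + m')) (\<beta> u (shift \<gamma> v)) = 0"
        by (rule Suc.hyps(1)) (use Suc nm in \<open>auto simp: shift_mem funpow_swap1\<close>)
      moreover have "n' + m = k" "n + m' = k" "n + m = Suc k" using Suc.hyps nm by auto
      moreover have "\<beta> (shift \<alpha> u) v \<in> V" "\<beta> u (shift \<gamma> v) \<in> V"
        using Suc.prems by (auto intro: endo_on_mem[OF l] endo_on_mem[OF r] shift_mem)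
      ultimately show ?thesis
        using Suc.prems
        by (simp add: funpow_swap1 shift endo_on_add[OF endo_on_funpow[OF endo_shift]])
    qed
  qed
  moreover have "\<beta> u v \<in> V" using n m endo_on_mem[OF r] by blast
  ultimately show ?thesis by (auto simp: gen_eigen_def)
qed

text \<open>The product of the generalized eigenspaces for \<open>\<alpha>\<close> and \<open>\<gamma>\<close> lies in that for \<open>\<alpha> + \<gamma>\<close>; hence any
additive function of the eigenvalue yields a derivation.\<close>

lemma gen_eigen_derivation:
  assumes \<beta>: "bilinear_on_V \<beta>"
    and X: "\<And>x y. x \<in> V \<Longrightarrow> y \<in> V \<Longrightarrow> X (\<beta> x y) = \<beta> (X x) y + \<beta> x (X y)"
    and T: "endo_on V T" "\<And>\<alpha> u. u \<in> gen_eigen \<alpha> \<Longrightarrow> T u = \<phi> \<alpha> \<cdot> u"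
    and \<phi>: "\<And>\<alpha> \<gamma>. \<phi> (\<alpha> + \<gamma>) = \<phi> \<alpha> + \<phi> \<gamma>"
    and x: "x \<in> V" and y: "y \<in> V"
  shows "T (\<beta> x y) = \<beta> (T x) y + \<beta> x (T y)"
proof -
  obtain B \<mu> where B: "basis_of V B" "\<And>b. b \<in> B \<Longrightarrow> b \<in> gen_eigen (\<mu> b)"
    using gen_eigen_basis by blast
  have BV: "b \<in> V" if "b \<in> B" for b using basis_of_mem[OF B(1) that] .
  have l: "endo_on V (\<lambda>x. \<beta> x y)" and r: "endo_on V (\<beta> y)" if "y \<in> V" for y
    using \<beta> that by (auto simp: bilinear_on_V_def)
  have add: "endo_on V (\<lambda>x. f x + g x)" if "endo_on V f" "endo_on V g" for f g
    using that subspace_V by (auto simp: endo_on_def subspace_add scale_right_distrib)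
  have basis: "T (\<beta> b c) = \<beta> (T b) c + \<beta> b (T c)" if "b \<in> B" "c \<in> B" for b c
    using T(2)[OF gen_eigen_product[OF \<beta> X B(2)[OF that(1)] B(2)[OF that(2)]]] that BV
    by (simp add: T(2)[OF B(2)] \<phi> endo_on_scale[OF l] endo_on_scale[OF r] scale_left_distrib)
  have left: "T (\<beta> u c) = \<beta> (T u) c + \<beta> u (T c)" if "u \<in> V" "c \<in> B" for u c
    by (rule endo_on_eqI[OF B(1) endo_on_comp[OF T(1) l] add[OF endo_on_comp[OF l T(1)] l] basis])
       (use that BV in \<open>auto intro: endo_on_mem[OF T(1)]\<close>)
  show ?thesis
    by (rule endo_on_eqI[OF B(1) endo_on_comp[OF T(1) r] add[OF r endo_on_comp[OF r T(1)]] left])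
       (use x y in \<open>auto intro: endo_on_mem[OF T(1)]\<close>)
qed

end

section \<open>Complexification\<close>

definition cscale :: "complex \<Rightarrow> 'a::real_vector \<times> 'a \<Rightarrow> 'a \<times> 'a" where
  "cscale c p = (Re c *\<^sub>R fst p - Im c *\<^sub>R snd p, Re c *\<^sub>R snd p + Im c *\<^sub>R fst p)"

global_interpretation cx: trace_space "cscale :: complex \<Rightarrow> 'a::real_vector \<times> 'a \<Rightarrow> 'a \<times> 'a"
  by unfold_locales
     (auto simp: cscale_def prod_eq_iff algebra_simps scaleR_add_right scaleR_add_left)

lemma cscale_real: "cscale c (b, 0) = (Re c *\<^sub>R b, Im c *\<^sub>R b)"
  by (simp add: cscale_def)

lemma fst_sum_pair: "fst (\<Sum>i\<in>I. f i) = (\<Sum>i\<in>I. fst (f i))"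
  and snd_sum_pair: "snd (\<Sum>i\<in>I. f i) = (\<Sum>i\<in>I. snd (f i))"
  for f :: "'i \<Rightarrow> 'a::real_vector \<times> 'b::real_vector"
  by (induction I rule: infinite_finite_induct) auto

lemma subspace_complexified: "subspace W \<Longrightarrow> cx.subspace (W \<times> W)"
  by (rule cx.subspaceI)
     (auto simp: cscale_def zero_prod_def subspace_0 subspace_add subspace_diff subspace_scale)

lemma basis_complexified:
  assumes "rv.basis_of W B"
  shows "cx.basis_of (W \<times> W) ((\<lambda>b. (b, 0)) ` B)" (is "cx.basis_of _ (?J ` B)")
proof -
  note W = rv.basis_of_subspace[OF assms]
  have B: "finite B" "independent B" "span B = W" using assms by (auto simp: rv.basis_of_def)
  have J: "inj_on ?J B" by (simp add: inj_on_def)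
  have "cx.independent (?J ` B)"
  proof (rule cx.independent_if_scalars_zero)
    fix f x assume *: "(\<Sum>x\<in>?J ` B. cscale (f x) x) = 0" and x: "x \<in> ?J ` B"
    have "(\<Sum>b\<in>B. cscale (f (b, 0)) (b, 0)) = 0" using * by (simp add: sum.reindex[OF J])
    then have "(\<Sum>b\<in>B. Re (f (b, 0)) *\<^sub>R b) = 0" "(\<Sum>b\<in>B. Im (f (b, 0)) *\<^sub>R b) = 0"
      by (auto simp: cscale_real prod_eq_iff fst_sum_pair snd_sum_pair)
    with x show "f x = 0"
      using independentD[OF B(2,1) subset_refl, of "\<lambda>b. Re (f (b, 0))"]
        independentD[OF B(2,1) subset_refl, of "\<lambda>b. Im (f (b, 0))"]
      by (auto simp: complex_eq_iff)
  qed (use B in simp)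
  moreover have "cx.span (?J ` B) \<subseteq> W \<times> W"
    by (rule cx.span_minimal[OF _ subspace_complexified[OF W]])
       (use rv.basis_of_mem[OF assms] subspace_0[OF W] in auto)
  moreover have "W \<times> W \<subseteq> cx.span (?J ` B)"
  proof
    fix p assume "p \<in> W \<times> W"
    then obtain u v where p: "p = (u, v)" "u \<in> W" "v \<in> W" by auto
    have "p = (\<Sum>b\<in>B. cscale (Complex (representation B u b) (representation B v b)) (b, 0))"
      using rv.basis_of_expand[OF assms p(2)] rv.basis_of_expand[OF assms p(3)]
      by (simp add: p(1) prod_eq_iff fst_sum_pair snd_sum_pair cscale_real)
    then show "p \<in> cx.span (?J ` B)"
      by (simp only:) (intro cx.span_sum cx.span_scale cx.span_base imageI)
  qed
  ultimately show ?thesis using B(1) by (auto simp: cx.basis_of_def)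
qed

lemma Re_representation_complexified:
  assumes "rv.basis_of W B" "p \<in> W \<times> W" "b \<in> B"
  shows "Re (cx.representation ((\<lambda>b. (b, 0)) ` B) p (b, 0)) = representation B (fst p) b"
proof -
  let ?J = "\<lambda>b. (b, 0)" and ?R = "cx.representation ((\<lambda>b. (b, 0)) ` B) p"
  have B: "finite B" "independent B" using assms(1) by (auto simp: rv.basis_of_def)
  have J: "inj_on ?J B" by (simp add: inj_on_def)
  have "p = (\<Sum>c\<in>B. cscale (?R (c, 0)) (c, 0))"
    using cx.basis_of_expand[OF basis_complexified[OF assms(1)] assms(2)] by (simp add: sum.reindex[OF J])
  from arg_cong[OF this, of fst] have "fst p = (\<Sum>c\<in>B. Re (?R (c, 0)) *\<^sub>R c)"
    by (simp add: fst_sum_pair cscale_real)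
  then have "representation B (fst p) b = (\<Sum>c\<in>B. Re (?R (c, 0)) * representation B c b)"
    using rv.basis_of_rep_sum[OF assms(1) rv.basis_of_mem[OF assms(1)]] by simp
  also have "\<dots> = (\<Sum>c\<in>B. if c = b then Re (?R (c, 0)) else 0)"
    by (intro sum.cong refl) (use B in \<open>auto simp: representation_basis\<close>)
  finally show ?thesis using assms(3) B by simp
qed

lemma Re_trace_complexified:
  assumes W: "rv.basis_of W B" and F: "cx.endo_on (W \<times> W) F"
    and f: "rv.endo_on W (\<lambda>x. fst (F (x, 0)))"
  shows "Re (cx.trace_on (W \<times> W) F) = rv.trace_on W (\<lambda>x. fst (F (x, 0)))"
proof -
  have mem: "(b, 0) \<in> W \<times> W" if "b \<in> B" for b
    using that rv.basis_of_mem[OF W] subspace_0[OF rv.basis_of_subspace[OF W]] by auto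
  have J: "inj_on (\<lambda>b. (b, 0)) B" by (simp add: inj_on_def)
  show ?thesis
    unfolding cx.trace_on_eq[OF basis_complexified[OF W] F] rv.trace_on_eq[OF W f] sum.reindex[OF J] Re_sum
    by (intro sum.cong refl) (simp add: Re_representation_complexified[OF W cx.endo_on_mem[OF F mem]])
qed

lemma endo_complexified: "rv.endo_on W f \<Longrightarrow> subspace W \<Longrightarrow> cx.endo_on (W \<times> W) (map_prod f f)"
  by (rule cx.endo_onI)
     (auto simp: cscale_def rv.endo_on_mem rv.endo_on_add rv.endo_on_diff rv.endo_on_scale subspace_scale
       rv.endo_on_add[of W f "_ *\<^sub>R _"])

text \<open>The operator \<open>T\<close> is the real part of the conjugate part of the complexified \<open>X\<close>, restricted to the
real vectors. Commuting with a real operator, being a derivation of a real product, and the real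
part of the trace are all compatible with taking real parts.\<close>

lemma conjugate_part_real:
  fixes W :: "'a::real_vector set"
  assumes W: "rv.basis_of W B" and X: "rv.endo_on W X"
  obtains T where "rv.endo_on W T"
    and "\<And>f x. rv.endo_on W f \<Longrightarrow> (\<And>x. x \<in> W \<Longrightarrow> f (X x) = X (f x)) \<Longrightarrow> x \<in> W \<Longrightarrow> f (T x) = T (f x)"
    and "\<And>\<beta> x y. (\<And>x. x \<in> W \<Longrightarrow> rv.endo_on W (\<beta> x)) \<Longrightarrow> (\<And>y. y \<in> W \<Longrightarrow> rv.endo_on W (\<lambda>x. \<beta> x y)) \<Longrightarrow>
      (\<And>x y. x \<in> W \<Longrightarrow> y \<in> W \<Longrightarrow> X (\<beta> x y) = \<beta> (X x) y + \<beta> x (X y)) \<Longrightarrow>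
      x \<in> W \<Longrightarrow> y \<in> W \<Longrightarrow> T (\<beta> x y) = \<beta> (T x) y + \<beta> x (T y)"
    and "rv.trace_on W (\<lambda>x. X (T x)) = 0 \<Longrightarrow> \<exists>n. \<forall>x\<in>W. (X ^^ n) x = 0"
proof -
  note sW = rv.basis_of_subspace[OF W]
  let ?V = "W \<times> W" and ?X = "map_prod X X"
  interpret complex_endo cscale ?V "(\<lambda>b. (b, 0)) ` B" ?X
    by unfold_locales (rule basis_complexified[OF W], rule endo_complexified[OF X sW])
  obtain Tc where Tc: "cx.endo_on ?V Tc" "\<And>\<alpha> u. u \<in> gen_eigen \<alpha> \<Longrightarrow> Tc u = cscale (cnj \<alpha>) u"
    and nil: "Re (cx.trace_on ?V (\<lambda>v. ?X (Tc v))) = 0 \<Longrightarrow> \<exists>n. \<forall>v\<in>?V. (?X ^^ n) v = 0"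
    using conjugate_part by auto
  define T where "T x = fst (Tc (x, 0))" for x
  have real: "(x, 0) \<in> ?V" if "x \<in> W" for x using that subspace_0[OF sW] by simp
  have T: "rv.endo_on W T"
  proof (rule rv.endo_onI)
    fix x assume x: "x \<in> W"
    show "T x \<in> W" using cx.endo_on_mem[OF Tc(1) real[OF x]] by (auto simp: T_def)
    show "T (c *\<^sub>R x) = c *\<^sub>R T x" for c
      using cx.endo_on_scale[OF Tc(1) real[OF x], of "complex_of_real c"]
      by (simp add: T_def cscale_def)
    show "T (x + y) = T x + T y" if "y \<in> W" for y
      using cx.endo_on_add[OF Tc(1) real[OF x] real[OF that]] by (simp add: T_def)
  qed
  have comm: "f (T x) = T (f x)"
    if f: "rv.endo_on W f" "\<And>x. x \<in> W \<Longrightarrow> f (X x) = X (f x)" and x: "x \<in> W" for f x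
  proof -
    have "map_prod f f (Tc (x, 0)) = Tc (map_prod f f (x, 0))"
      by (rule gen_eigen_commutant[OF endo_complexified[OF f(1) sW] _ Tc real[OF x]]) (auto simp: f(2))
    from arg_cong[OF this, of fst] show ?thesis
      using rv.endo_on_zero[OF f(1) sW] by (simp add: T_def map_prod_def split_beta)
  qed
  have der: "T (\<beta> x y) = \<beta> (T x) y + \<beta> x (T y)"
    if \<beta>: "\<And>x. x \<in> W \<Longrightarrow> rv.endo_on W (\<beta> x)" "\<And>y. y \<in> W \<Longrightarrow> rv.endo_on W (\<lambda>x. \<beta> x y)"
      "\<And>x y. x \<in> W \<Longrightarrow> y \<in> W \<Longrightarrow> X (\<beta> x y) = \<beta> (X x) y + \<beta> x (X y)"
      and xy: "x \<in> W" "y \<in> W" for \<beta> x y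
  proof -
    let ?\<beta> = "\<lambda>p q. (\<beta> (fst p) (fst q) - \<beta> (snd p) (snd q), \<beta> (fst p) (snd q) + \<beta> (snd p) (fst q))"
    note r = \<beta>(1) and l = \<beta>(2)
    note rules = rv.endo_on_mem[OF r] rv.endo_on_add[OF r] rv.endo_on_diff[OF r sW] rv.endo_on_scale[OF r]
      rv.endo_on_add[OF l] rv.endo_on_diff[OF l sW] rv.endo_on_scale[OF l]
      subspace_add[OF sW] subspace_diff[OF sW] subspace_scale[OF sW]
    have "bilinear_on_V ?\<beta>"
      unfolding bilinear_on_V_def
      by (intro conjI ballI cx.endo_onI) (auto simp: rules cscale_def algebra_simps)
    moreover have "?X (?\<beta> p q) = ?\<beta> (?X p) q + ?\<beta> p (?X q)" if "p \<in> ?V" "q \<in> ?V" for p q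
      using that by (auto simp: rules \<beta>(3) rv.endo_on_add[OF X] rv.endo_on_diff[OF X sW])
    ultimately have "Tc (?\<beta> (x, 0) (y, 0)) = ?\<beta> (Tc (x, 0)) (y, 0) + ?\<beta> (x, 0) (Tc (y, 0))"
      by (rule gen_eigen_derivation[where \<phi> = cnj]) (use Tc real xy in auto)
    then show ?thesis
      using xy subspace_0[OF sW] rv.endo_on_zero[OF r sW] rv.endo_on_zero[OF l sW]
        cx.endo_on_mem[OF Tc(1) real] by (simp add: T_def mem_Times_iff)
  qed
  have nilp: "\<exists>n. \<forall>x\<in>W. (X ^^ n) x = 0" if 0: "rv.trace_on W (\<lambda>x. X (T x)) = 0"
  proof -
    have "rv.endo_on W (\<lambda>x. fst (?X (Tc (x, 0))))"
      using rv.endo_on_comp[OF X T] by (simp add: T_def)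
    then have "Re (cx.trace_on ?V (\<lambda>v. ?X (Tc v))) = 0"
      using Re_trace_complexified[OF W cx.endo_on_comp[OF endo_X Tc(1)]] 0 by (simp add: T_def)
    then obtain n where n: "\<And>v. v \<in> ?V \<Longrightarrow> (?X ^^ n) v = 0" using nil by blast
    have "fst ((?X ^^ n) p) = (X ^^ n) (fst p)" for p by (induction n) auto
    then have "\<forall>x\<in>W. (X ^^ n) x = 0" using n real by (metis fst_conv fst_zero)
    then show ?thesis by blast
  qed
  show thesis using that[OF T] comm der nilp by blast
qed

section \<open>Linear algebra of a bilinear form\<close>

text \<open>The endomorphism \<open>x \<mapsto> \<Sum>b\<in>B. K x b *\<^sub>R b\<close> of \<open>W\<close> is injective, because \<open>K\<close> is nondegenerate,
hence onto for reasons of dimension. A preimage of \<open>\<Sum>b\<in>B. \<phi> b *\<^sub>R b\<close> represents \<open>\<phi>\<close>.\<close>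

lemma form_represents:
  fixes K :: "'a::real_vector \<Rightarrow> 'a \<Rightarrow> real"
  assumes W: "rv.basis_of W B"
    and left: "\<And>c x x' y. x \<in> W \<Longrightarrow> x' \<in> W \<Longrightarrow> y \<in> W \<Longrightarrow> K (c *\<^sub>R x + x') y = c * K x y + K x' y"
    and right: "\<And>c x y y'. x \<in> W \<Longrightarrow> y \<in> W \<Longrightarrow> y' \<in> W \<Longrightarrow> K x (c *\<^sub>R y + y') = c * K x y + K x y'"
    and nondeg: "\<And>x. x \<in> W \<Longrightarrow> (\<And>y. y \<in> W \<Longrightarrow> K x y = 0) \<Longrightarrow> x = 0"
    and \<phi>: "\<And>c y y'. y \<in> W \<Longrightarrow> y' \<in> W \<Longrightarrow> \<phi> (c *\<^sub>R y + y') = c * \<phi> y + \<phi> y'"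
  shows "\<exists>x\<in>W. \<forall>y\<in>W. K x y = \<phi> y"
proof -
  note sW = rv.basis_of_subspace[OF W] and BW = rv.basis_of_mem[OF W]
  have B: "finite B" "independent B" "span B = W" using W by (auto simp: rv.basis_of_def)
  define \<Phi> where "\<Phi> x = (\<Sum>b\<in>B. K x b *\<^sub>R b)" for x
  have sumW: "(\<Sum>b\<in>B. c b *\<^sub>R b) \<in> W" for c
    using BW sW by (intro subspace_sum subspace_scale) auto
  have coeffs: "c b = d b" if "(\<Sum>b\<in>B. c b *\<^sub>R b) = (\<Sum>b\<in>B. d b *\<^sub>R b)" "b \<in> B" for c d b
  proof -
    have "(\<Sum>b\<in>B. (c b - d b) *\<^sub>R b) = 0" using that by (simp add: scaleR_diff_left sum_subtractf)
    from independentD[OF B(2,1) subset_refl this that(2)] show ?thesis by simp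
  qed
  have eq_on: "\<psi> y = \<psi>' y"
    if lin: "\<And>c y y'. y \<in> W \<Longrightarrow> y' \<in> W \<Longrightarrow> \<psi> (c *\<^sub>R y + y') = c * \<psi> y + \<psi> y'"
      "\<And>c y y'. y \<in> W \<Longrightarrow> y' \<in> W \<Longrightarrow> \<psi>' (c *\<^sub>R y + y') = c * \<psi>' y + \<psi>' y'"
      and eq: "\<And>b. b \<in> B \<Longrightarrow> \<psi> b = \<psi>' b" and y: "y \<in> W" for \<psi> \<psi>' :: "'a \<Rightarrow> real" and y
  proof -
    have 0: "0 \<in> W" using sW by (rule subspace_0)
    have "y \<in> W \<and> \<psi> y = \<psi>' y" if "y \<in> span B" for y
      using that
    proof (induction rule: span_induct_alt)
      case base
      show ?case using lin(1)[OF 0 0, of 1] lin(2)[OF 0 0, of 1] 0 by simp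
    next
      case (step c b y)
      then show ?case using lin eq BW sW by (simp add: subspace_add subspace_scale)
    qed
    then show ?thesis using y B(3) by blast
  qed
  have \<Phi>: "rv.endo_on W \<Phi>"
  proof (rule rv.endo_onI)
    show "\<Phi> x \<in> W" for x unfolding \<Phi>_def by (rule sumW)
    show "\<Phi> (x + y) = \<Phi> x + \<Phi> y" if "x \<in> W" "y \<in> W" for x y
      using left[OF that BW, of _ 1] by (simp add: \<Phi>_def scaleR_add_left sum.distrib)
    show "\<Phi> (c *\<^sub>R x) = c *\<^sub>R \<Phi> x" if "x \<in> W" for c x
    proof -
      have "K 0 b = 0" if "b \<in> B" for b
        using left[OF subspace_0[OF sW] subspace_0[OF sW] BW[OF that], of 1] by simp
      then have "K (c *\<^sub>R x) b = c * K x b" if "b \<in> B" for b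
        using left[OF \<open>x \<in> W\<close> subspace_0[OF sW] BW[OF that], of c] that by simp
      then show ?thesis by (simp add: \<Phi>_def scaleR_sum_right)
    qed
  qed
  have inj: "x = 0" if "x \<in> W" "\<Phi> x = 0" for x
  proof (rule nondeg[OF that(1)])
    fix y assume y: "y \<in> W"
    have "K x b = 0" if "b \<in> B" for b
      using coeffs[of "K x" "\<lambda>_. 0", OF _ that] \<open>\<Phi> x = 0\<close> by (simp add: \<Phi>_def)
    then show "K x y = 0"
      by (intro eq_on[of "K x" "\<lambda>_. 0", OF right[OF that(1)] _ _ y]) auto
  qed
  have "\<exists>x\<in>W. \<Phi> x = t" if t: "t \<in> W" for t
  proof -
    have injB: "inj_on \<Phi> B"
    proof (rule inj_onI)
      fix b c assume bc: "b \<in> B" "c \<in> B" "\<Phi> b = \<Phi> c"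
      then have "\<Phi> (b - c) = 0" by (simp add: rv.endo_on_diff[OF \<Phi> sW] BW)
      then show "b = c" using inj[of "b - c"] bc BW subspace_diff[OF sW] by simp
    qed
    have comb: "(\<Sum>w\<in>\<Phi> ` B. c w *\<^sub>R w) = \<Phi> (\<Sum>b\<in>B. c (\<Phi> b) *\<^sub>R b)" for c
    proof -
      have "\<Phi> (\<Sum>b\<in>B. c (\<Phi> b) *\<^sub>R b) = (\<Sum>b\<in>B. \<Phi> (c (\<Phi> b) *\<^sub>R b))"
        by (rule rv.endo_on_sum[OF \<Phi> sW]) (use BW sW in \<open>simp add: subspace_scale\<close>)
      also have "\<dots> = (\<Sum>b\<in>B. c (\<Phi> b) *\<^sub>R \<Phi> b)"
        by (intro sum.cong refl rv.endo_on_scale[OF \<Phi>] BW)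
      finally show ?thesis by (simp add: sum.reindex[OF injB])
    qed
    have ind: "independent (\<Phi> ` B)"
    proof (rule real_vector.independent_if_scalars_zero)
      fix c w assume c: "(\<Sum>w\<in>\<Phi> ` B. c w *\<^sub>R w) = 0" and w: "w \<in> \<Phi> ` B"
      then have "(\<Sum>b\<in>B. c (\<Phi> b) *\<^sub>R b) = 0" using comb[of c] inj[OF sumW[of "\<lambda>b. c (\<Phi> b)"]] by simp
      then show "c w = 0"
        using w coeffs[of "\<lambda>b. c (\<Phi> b)" "\<lambda>_. 0"] by auto
    qed (use B in simp)
    have sub: "insert t (\<Phi> ` B) \<subseteq> span B" using t rv.endo_on_mem[OF \<Phi> BW] B(3) by auto
    have "t \<in> span (\<Phi> ` B)"
    proof (rule ccontr)
      assume n: "t \<notin> span (\<Phi> ` B)"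
      then have "independent (insert t (\<Phi> ` B))" using ind by (rule real_vector.independent_insertI)
      from real_vector.independent_span_bound[OF B(1) this sub]
      have "card (insert t (\<Phi> ` B)) \<le> card B" by simp
      moreover have "t \<notin> \<Phi> ` B" using n span_base[of t "\<Phi> ` B"] by auto
      ultimately show False using B(1) by (simp add: card_image[OF injB])
    qed
    then obtain c where "t = (\<Sum>w\<in>\<Phi> ` B. c w *\<^sub>R w)"
      using B(1) by (auto simp: span_finite)
    then have "\<Phi> (\<Sum>b\<in>B. c (\<Phi> b) *\<^sub>R b) = t" using comb by simp
    then show ?thesis using sumW[of "\<lambda>b. c (\<Phi> b)"] by blast
  qed
  from this[OF sumW[of \<phi>]] obtain x where x: "x \<in> W" "\<Phi> x = (\<Sum>b\<in>B. \<phi> b *\<^sub>R b)" by blast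
  have "K x b = \<phi> b" if "b \<in> B" for b
    using coeffs[of "K x" \<phi>, OF _ that] x(2) by (simp add: \<Phi>_def)
  then have "K x y = \<phi> y" if "y \<in> W" for y
    using eq_on[of "K x" \<phi>, OF right[OF x(1)] \<phi> _ that] by blast
  with x(1) show ?thesis by blast
qed

section \<open>Ideals and nilpotent actions in a Lie algebra\<close>

context lie_algebra
begin

lemmas br_simps = bilinear_ladd[OF bilinear_br] bilinear_radd[OF bilinear_br]
  bilinear_lsub[OF bilinear_br] bilinear_rsub[OF bilinear_br]
  bilinear_lmul[OF bilinear_br] bilinear_rmul[OF bilinear_br]
  bilinear_lzero[OF bilinear_br] bilinear_rzero[OF bilinear_br]
  bilinear_lneg[OF bilinear_br] bilinear_rneg[OF bilinear_br]

lemma br_flip: "br x y = - br y x"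
proof -
  have "br x y + br y x = br (x + y) (x + y) - br x x - br y y" by (simp add: br_simps)
  then have "br x y + br y x = 0" by (simp add: br_self)
  then show ?thesis by (simp add: eq_neg_iff_add_eq_0)
qed

lemma br_br_left: "br (br x y) z = br x (br y z) - br y (br x z)"
proof -
  have "br (br x y) z = - br z (br x y)" "br y (br z x) = - br y (br x z)"
    by (rule br_flip) (subst br_flip[of z x], simp add: br_simps)
  with jacobi[of x y z] show ?thesis by (simp add: algebra_simps add_eq_0_iff)
qed

lemma br_derivation: "br x (br y z) = br (br x y) z + br y (br x z)"
  by (simp add: br_br_left)

lemma basis_exists: "subspace (W :: 'a set) \<Longrightarrow> \<exists>B. rv.basis_of W B"
proof -
  assume W: "subspace W"
  obtain F :: "'a set" where F: "finite F" "span F = UNIV" using finite_dim by blast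
  show ?thesis by (rule rv.basis_of_exists[OF W _ F(1)]) (simp add: F(2))
qed

lemma dim_strict_mono:
  assumes "subspace (U :: 'a set)" "subspace W" "U \<subset> W"
  shows "dim U < dim W"
proof -
  obtain B C0 where B: "rv.basis_of U B" and C0: "rv.basis_of W C0" using basis_exists[OF assms(1)] basis_exists[OF assms(2)] by blast
  obtain C where C: "rv.basis_of W C" "B \<subseteq> C"
    using rv.basis_of_extend[OF B _ assms(2) C0] assms(3) by blast
  have "B \<noteq> C" using B C assms(3) by (auto simp: rv.basis_of_def)
  then have "card B < card C" using C by (intro psubset_card_mono) (auto simp: rv.basis_of_def)
  moreover have "dim U = card B" "dim W = card C"
    using B C(1) dim_eq_card_independent[of B] dim_eq_card_independent[of C]
    by (auto simp: rv.basis_of_def)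
  ultimately show ?thesis by simp
qed

definition ideal_in :: "'a set \<Rightarrow> 'a set \<Rightarrow> bool" where
  "ideal_in H I \<longleftrightarrow> subspace I \<and> I \<subseteq> H \<and> (\<forall>x\<in>H. \<forall>y\<in>I. br x y \<in> I)"

definition minimal_ideal_in :: "'a set \<Rightarrow> 'a set \<Rightarrow> bool" where
  "minimal_ideal_in H m \<longleftrightarrow> ideal_in H m \<and> m \<noteq> {0} \<and>
     (\<forall>I. ideal_in H I \<longrightarrow> I \<subseteq> m \<longrightarrow> I = {0} \<or> I = m)"

lemma minimal_ideal_exists:
  assumes "ideal_in H I" "I \<noteq> {0}"
  shows "\<exists>m\<subseteq>I. minimal_ideal_in H m"
proof -
  let ?P = "\<lambda>J. ideal_in H J \<and> J \<noteq> {0} \<and> J \<subseteq> I"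
  obtain m where m: "?P m" "\<And>J. ?P J \<Longrightarrow> dim m \<le> dim J"
    using ex_has_least_nat[of ?P I dim] assms by blast
  have "J = {0} \<or> J = m" if "ideal_in H J" "J \<subseteq> m" for J
  proof (rule ccontr)
    assume J: "\<not> (J = {0} \<or> J = m)"
    then have "dim J < dim m"
      using that m(1) by (intro dim_strict_mono) (auto simp: ideal_in_def)
    moreover have "dim m \<le> dim J" using J that m(1) by (intro m(2)) auto
    ultimately show False by simp
  qed
  then show ?thesis using m(1) by (auto simp: minimal_ideal_in_def)
qed

lemma bracket_span_stable:
  assumes "\<And>u. u \<in> I \<Longrightarrow> br x u \<in> I" "\<And>u. u \<in> J \<Longrightarrow> br x u \<in> J" "v \<in> bracket_span br I J"
  shows "br x v \<in> bracket_span br I J"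
  using assms(3) unfolding bracket_span_def
proof (induction rule: span_induct_alt)
  case base
  show ?case by (simp add: br_simps span_zero)
next
  case (step c s v)
  let ?S = "{br a b | a b. a \<in> I \<and> b \<in> J}"
  obtain a b where s: "s = br a b" "a \<in> I" "b \<in> J" using step by blast
  have "br x s = br (br x a) b + br a (br x b)" unfolding s(1) by (rule br_derivation)
  moreover have "br (br x a) b \<in> ?S" "br a (br x b) \<in> ?S" using s(2,3) assms(1,2) by blast+
  ultimately have "br x s \<in> span ?S" by (simp add: span_add span_base)
  with step show ?case by (simp add: br_simps span_add span_scale)
qed

lemma bracket_span_subset:
  assumes "subspace W" "\<And>a b. a \<in> I \<Longrightarrow> b \<in> J \<Longrightarrow> br a b \<in> W"
  shows "bracket_span br I J \<subseteq> W"
  unfolding bracket_span_def by (rule span_minimal) (use assms in auto)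

lemma br_in_bracket_span: "a \<in> I \<Longrightarrow> b \<in> J \<Longrightarrow> br a b \<in> bracket_span br I J"
  unfolding bracket_span_def by (rule span_base) blast

lemma bracket_span_ideal:
  assumes "ideal_in H I" "ideal_in H J"
  shows "ideal_in H (bracket_span br I J)"
proof -
  have "bracket_span br I J \<subseteq> J"
    using assms by (intro bracket_span_subset) (auto simp: ideal_in_def)
  moreover have "subspace (bracket_span br I J)" by (simp add: bracket_span_def)
  ultimately show ?thesis
    using assms bracket_span_stable[of I _ J] by (auto simp: ideal_in_def)
qed

text \<open>Engel's theorem, for a subalgebra \<open>H\<close> acting on the quotient \<open>W / U\<close>. The quotient is there for
the induction, which applies the statement to the action of a maximal proper subalgebra \<open>M\<close> on
\<open>H / M\<close>. This gives \<open>y\<close> normalizing \<open>M\<close>, and \<open>H = M + \<real> y\<close> by maximality. The vectors of \<open>W\<close> that \<open>M\<close>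
maps into \<open>U\<close> are then stable under \<open>y\<close>, which is nilpotent modulo \<open>U\<close>.\<close>

theorem engel:
  assumes "lie_subalgebra br H" "\<And>x. x \<in> H \<Longrightarrow> \<exists>n. \<forall>y\<in>H. (br x ^^ n) y = 0"
    and "subspace U" "subspace W" "U \<subset> W"
    and "\<And>x u. x \<in> H \<Longrightarrow> u \<in> U \<Longrightarrow> br x u \<in> U" "\<And>x w. x \<in> H \<Longrightarrow> w \<in> W \<Longrightarrow> br x w \<in> W"
    and "\<And>x w. x \<in> H \<Longrightarrow> w \<in> W \<Longrightarrow> \<exists>n. (br x ^^ n) w \<in> U"
  shows "\<exists>w\<in>W - U. \<forall>x\<in>H. br x w \<in> U"
  using assms
proof (induction "dim H" arbitrary: H U W rule: less_induct)
  case less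
  note sH = less.prems(1) and U = less.prems(3) and W = less.prems(4)
  have H: "subspace H" "\<And>x y. x \<in> H \<Longrightarrow> y \<in> H \<Longrightarrow> br x y \<in> H"
    using sH by (auto simp: lie_subalgebra_def)
  show ?case
  proof (cases "H = {0}")
    case True
    then show ?thesis using less.prems(5) subspace_0[OF U] by (auto simp: br_simps)
  next
    case False
    let ?P = "\<lambda>M. lie_subalgebra br M \<and> M \<subset> H"
    have "?P {0}" using False subspace_0[OF H(1)]
      by (auto simp: lie_subalgebra_def br_simps subspace_def)
    moreover have bound: "dim M < dim H" if "?P M" for M
      using that H(1) by (intro dim_strict_mono) (auto simp: lie_subalgebra_def)
    then have "\<forall>M. ?P M \<longrightarrow> dim M < dim H" by blast
    ultimately obtain M where M: "?P M" "\<And>N. ?P N \<Longrightarrow> dim N \<le> dim M"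
      using ex_has_greatest_nat[of ?P "{0}" dim "dim H"] by (metis (lifting) less_imp_le)
    have sM: "subspace M" "\<And>x y. x \<in> M \<Longrightarrow> y \<in> M \<Longrightarrow> br x y \<in> M" and MH: "M \<subseteq> H"
      using M(1) by (auto simp: lie_subalgebra_def)
    have nilM: "\<exists>n. \<forall>y\<in>M. (br x ^^ n) y = 0" if "x \<in> M" for x
      using less.prems(2)[of x] that MH by blast
    have "\<exists>y\<in>H - M. \<forall>x\<in>M. br x y \<in> M"
    proof (rule less.hyps[OF bound[OF M(1)] _ nilM sM(1) H(1)])
      show "\<exists>n. (br x ^^ n) w \<in> M" if "x \<in> M" "w \<in> H" for x w
      proof -
        obtain n where "\<forall>y\<in>H. (br x ^^ n) y = 0" using less.prems(2) \<open>x \<in> M\<close> MH by blast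
        then have "(br x ^^ n) w \<in> M" using \<open>w \<in> H\<close> subspace_0[OF sM(1)] by simp
        then show ?thesis ..
      qed
    qed (use M(1) H(2) sM MH in auto)
    then obtain y where y: "y \<in> H" "y \<notin> M" "\<And>x. x \<in> M \<Longrightarrow> br x y \<in> M" by blast
    define N where "N = {v. \<exists>k. v - k *\<^sub>R y \<in> M}"
    have "N = span (insert y M)"
      using sM(1) by (simp add: N_def span_insert span_eq_iff[THEN iffD2])
    then have sN: "subspace N" by simp
    have "br v w \<in> N" if v: "v \<in> N" and w: "w \<in> N" for v w
    proof -
      obtain k l where kl: "v - k *\<^sub>R y \<in> M" "w - l *\<^sub>R y \<in> M" using v w by (auto simp: N_def)
      define a b where "a = v - k *\<^sub>R y" and "b = w - l *\<^sub>R y"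
      have "br v w = br (a + k *\<^sub>R y) (b + l *\<^sub>R y)" by (simp add: a_def b_def)
      also have "\<dots> = br a b + l *\<^sub>R br a y - k *\<^sub>R br b y"
        by (simp add: br_simps br_self br_flip[of y b])
      also have "\<dots> \<in> M"
        using kl y(3) sM(2) unfolding a_def[symmetric] b_def[symmetric]
        by (intro subspace_diff[OF sM(1)] subspace_add[OF sM(1)] subspace_scale[OF sM(1)]) auto
      finally have "br v w - 0 *\<^sub>R y \<in> M" by simp
      then show ?thesis unfolding N_def by blast
    qed
    then have "lie_subalgebra br N" using sN by (simp add: lie_subalgebra_def)
    moreover have "N \<subseteq> H"
    proof
      fix v assume "v \<in> N"
      then obtain k where "v - k *\<^sub>R y \<in> H" using MH by (auto simp: N_def)
      then have "(v - k *\<^sub>R y) + k *\<^sub>R y \<in> H"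
        using y(1) by (intro subspace_add[OF H(1)] subspace_scale[OF H(1)])
      then show "v \<in> H" by simp
    qed
    moreover have "M \<subset> N"
    proof
      have "insert y M \<subseteq> N" unfolding \<open>N = span (insert y M)\<close> by (rule span_superset)
      then show "M \<subseteq> N" and "M \<noteq> N" using y(2) by auto
    qed
    then have "\<not> dim N \<le> dim M" using dim_strict_mono[OF sM(1) sN] by simp
    ultimately have NH: "N = H" using M(2)[of N] by blast
    have "\<exists>w\<in>W - U. \<forall>x\<in>M. br x w \<in> U"
      by (rule less.hyps[OF bound[OF M(1)] _ nilM U W less.prems(5)])
         (use M(1) MH less.prems(6-8) in auto)
    then obtain w0 where w0: "w0 \<in> W" "w0 \<notin> U" "\<And>x. x \<in> M \<Longrightarrow> br x w0 \<in> U" by blast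
    have pow: "(br y ^^ n) w0 \<in> W \<and> (\<forall>x\<in>M. br x ((br y ^^ n) w0) \<in> U)" for n
    proof (induction n)
      case 0
      then show ?case using w0 by simp
    next
      case (Suc n)
      let ?w = "(br y ^^ n) w0"
      have "br x (br y ?w) \<in> U" if "x \<in> M" for x
        unfolding br_derivation[of x y ?w]
        using Suc y(1,3) less.prems(6) that by (intro subspace_add[OF U]) auto
      then show ?case using Suc y(1) less.prems(7) by simp
    qed
    obtain n where "(br y ^^ n) w0 \<in> U" using less.prems(8) y(1) w0(1) by blast
    then obtain k where k: "(br y ^^ k) w0 \<notin> U" "(br y ^^ Suc k) w0 \<in> U"
    proof (induction n)
      case 0
      then show ?case using w0(2) by simp
    next
      case (Suc n)
      then show ?case by (cases "(br y ^^ n) w0 \<in> U") auto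
    qed
    have "br x ((br y ^^ k) w0) \<in> U" if x: "x \<in> H" for x
    proof -
      let ?v = "(br y ^^ k) w0"
      obtain c where c: "x - c *\<^sub>R y \<in> M" using x NH by (auto simp: N_def)
      have "br x ?v = br (x - c *\<^sub>R y) ?v + c *\<^sub>R br y ?v" by (simp add: br_simps)
      then show ?thesis
        using c pow k(2) subspace_add[OF U] subspace_scale[OF U] by simp
    qed
    then show ?thesis using pow k(1) by blast
  qed
qed

definition stabilizes :: "'a set \<Rightarrow> 'a \<Rightarrow> bool" where
  "stabilizes W x \<longleftrightarrow> (\<forall>v\<in>W. br x v \<in> W)"

lemma endo_br: "stabilizes W x \<Longrightarrow> rv.endo_on W (br x)"
  by (rule rv.endo_onI) (auto simp: stabilizes_def br_simps)

lemma stabilizes_br: "subspace W \<Longrightarrow> stabilizes W x \<Longrightarrow> stabilizes W y \<Longrightarrow> stabilizes W (br x y)"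
  by (simp add: stabilizes_def br_br_left subspace_diff)

lemma stabilizes_lincomb:
  "subspace W \<Longrightarrow> stabilizes W x \<Longrightarrow> stabilizes W y \<Longrightarrow> stabilizes W (c *\<^sub>R x + y)"
  by (simp add: stabilizes_def br_simps subspace_add subspace_scale)

lemma trace_br_lincomb:
  assumes "rv.basis_of W B" "rv.endo_on W T" "stabilizes W x" "stabilizes W y"
  shows "rv.trace_on W (\<lambda>v. br (c *\<^sub>R x + y) (T v))
    = c * rv.trace_on W (\<lambda>v. br x (T v)) + rv.trace_on W (\<lambda>v. br y (T v))"
  using rv.trace_on_lincomb[OF assms(1) rv.endo_on_comp[OF endo_br assms(2)]
      rv.endo_on_comp[OF endo_br assms(2)], OF assms(3,4)]
  by (simp add: br_simps)

lemma trace_br_span_zero: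
  assumes W: "rv.basis_of W B" and T: "rv.endo_on W T"
    and S: "\<And>s. s \<in> S \<Longrightarrow> stabilizes W s \<and> rv.trace_on W (\<lambda>v. br s (T v)) = 0"
    and y: "y \<in> span S"
  shows "stabilizes W y \<and> rv.trace_on W (\<lambda>v. br y (T v)) = 0"
  using y
proof (induction rule: span_induct_alt)
  case base
  show ?case
    using subspace_0[OF rv.basis_of_subspace[OF W]] rv.trace_on_zero[OF W]
    by (simp add: stabilizes_def br_simps)
next
  case (step c x y)
  then show ?case
    using S[OF step(1)] trace_br_lincomb[OF W T] stabilizes_lincomb[OF rv.basis_of_subspace[OF W]]
    by simp
qed

text \<open>In terms of operators: \<open>tr ([a,b] \<circ> T) = tr (a \<circ> [b,T])\<close>.\<close>

lemma trace_br_commutator: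
  assumes W: "rv.basis_of W B" and T: "rv.endo_on W T" and ab: "stabilizes W a" "stabilizes W b"
  shows "rv.trace_on W (\<lambda>v. br (br a b) (T v)) = rv.trace_on W (\<lambda>v. br a (br b (T v) - T (br b v)))"
proof -
  note a = endo_br[OF ab(1)] and b = endo_br[OF ab(2)]
  note abT = rv.endo_on_comp[OF a rv.endo_on_comp[OF b T]]
  have "rv.trace_on W (\<lambda>v. br (br a b) (T v))
      = rv.trace_on W (\<lambda>v. br a (br b (T v))) - rv.trace_on W (\<lambda>v. br b (br a (T v)))"
    unfolding br_br_left by (rule rv.trace_on_diff[OF W abT rv.endo_on_comp[OF b rv.endo_on_comp[OF a T]]])
  also have "rv.trace_on W (\<lambda>v. br b (br a (T v))) = rv.trace_on W (\<lambda>v. br a (T (br b v)))"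
    by (rule rv.trace_on_comm[OF W b rv.endo_on_comp[OF a T]])
  also have "rv.trace_on W (\<lambda>v. br a (br b (T v))) - rv.trace_on W (\<lambda>v. br a (T (br b v)))
      = rv.trace_on W (\<lambda>v. br a (br b (T v)) - br a (T (br b v)))"
    by (rule rv.trace_on_diff[OF W abT rv.endo_on_comp[OF a rv.endo_on_comp[OF T b]], symmetric])
  finally show ?thesis by (simp add: br_simps)
qed

text \<open>Let \<open>T\<close> be the conjugate part of \<open>y\<close> on \<open>W\<close>. Each \<open>b\<close> commutes with \<open>y\<close>, hence with \<open>T\<close>, so
\<open>tr ([a,b] \<circ> T) = tr (a \<circ> [b,T]) = 0\<close>, and therefore \<open>tr (y \<circ> T) = 0\<close>.\<close>

lemma nilpotent_if_commutators_with_centralizer: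
  assumes W: "subspace W"
    and y: "y \<in> span {br a b | a b. stabilizes W a \<and> stabilizes W b \<and> (\<forall>v\<in>W. br b (br y v) = br y (br b v))}"
      (is "y \<in> span ?S")
  shows "\<exists>n. \<forall>v\<in>W. (br y ^^ n) v = 0"
proof -
  obtain B where B: "rv.basis_of W B" using basis_exists[OF W] by blast
  have "stabilizes W y"
  proof -
    have "?S \<subseteq> {x. stabilizes W x}" using stabilizes_br[OF W] by blast
    moreover have "subspace {x. stabilizes W x}"
      using W by (auto simp: subspace_def stabilizes_def br_simps)
    ultimately show ?thesis using y span_minimal by blast
  qed
  from endo_br[OF this] obtain T where T: "rv.endo_on W T"
    and comm: "\<And>f x. rv.endo_on W f \<Longrightarrow> (\<And>x. x \<in> W \<Longrightarrow> f (br y x) = br y (f x)) \<Longrightarrow> x \<in> W \<Longrightarrow> f (T x) = T (f x)"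
    and nil: "rv.trace_on W (\<lambda>v. br y (T v)) = 0 \<Longrightarrow> \<exists>n. \<forall>v\<in>W. (br y ^^ n) v = 0"
    by (rule conjugate_part_real[OF B]) blast
  have "stabilizes W s \<and> rv.trace_on W (\<lambda>v. br s (T v)) = 0" if s: "s \<in> ?S" for s
  proof -
    obtain a b where ab: "s = br a b" "stabilizes W a" "stabilizes W b" "\<And>v. v \<in> W \<Longrightarrow> br b (br y v) = br y (br b v)"
      using s by blast
    have "rv.trace_on W (\<lambda>v. br s (T v)) = rv.trace_on W (\<lambda>v. br a (br b (T v) - T (br b v)))"
      unfolding ab(1) by (rule trace_br_commutator[OF B T ab(2,3)])
    also have "\<dots> = rv.trace_on W (\<lambda>v. 0)"
    proof (rule rv.trace_on_cong[OF B])
      show "rv.endo_on W (\<lambda>v. br a (br b (T v) - T (br b v)))"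
        by (rule rv.endo_on_comp[OF endo_br[OF ab(2)] rv.endo_on_diff_fun[OF
              rv.endo_on_comp[OF endo_br[OF ab(3)] T] rv.endo_on_comp[OF T endo_br[OF ab(3)]] W]])
      show "br a (br b (T v) - T (br b v)) = 0" if "v \<in> W" for v
        using comm[OF endo_br[OF ab(3)] ab(4) that] by (simp add: br_simps)
    qed
    finally show ?thesis using rv.trace_on_zero[OF B] stabilizes_br[OF W] ab by simp
  qed
  from nil trace_br_span_zero[OF B T this y] show ?thesis by blast
qed

definition trace_form :: "'a set \<Rightarrow> 'a \<Rightarrow> 'a \<Rightarrow> real" where
  "trace_form W x y = rv.trace_on W (\<lambda>v. br x (br y v))"

lemma trace_form_sym:
  "subspace W \<Longrightarrow> stabilizes W x \<Longrightarrow> stabilizes W y \<Longrightarrow> trace_form W x y = trace_form W y x"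
  unfolding trace_form_def using basis_exists[of W] rv.trace_on_comm[OF _ endo_br endo_br] by blast

lemma trace_form_left:
  assumes "subspace W" "stabilizes W x" "stabilizes W x'" "stabilizes W y"
  shows "trace_form W (c *\<^sub>R x + x') y = c * trace_form W x y + trace_form W x' y"
proof -
  obtain B where B: "rv.basis_of W B" using basis_exists[OF assms(1)] by blast
  show ?thesis
    unfolding trace_form_def by (rule trace_br_lincomb[OF B endo_br[OF assms(4)] assms(2,3)])
qed

lemma trace_form_right:
  assumes "subspace W" "stabilizes W x" "stabilizes W y" "stabilizes W y'"
  shows "trace_form W x (c *\<^sub>R y + y') = c * trace_form W x y + trace_form W x y'"
  using assms trace_form_left[of W y y' x c] by (simp add: trace_form_sym[of W x] stabilizes_lincomb)

lemma trace_form_invariant: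
  assumes W: "subspace W" and x: "stabilizes W x" and y: "stabilizes W y" and z: "stabilizes W z"
  shows "trace_form W (br x y) z = trace_form W x (br y z)"
proof -
  obtain B where B: "rv.basis_of W B" using basis_exists[OF W] by blast
  show ?thesis
    unfolding trace_form_def trace_br_commutator[OF B endo_br[OF z] x y] by (simp add: br_br_left)
qed

text \<open>The conjugate part \<open>T\<close> of \<open>ad y\<close> is a derivation of \<open>m\<close>, so \<open>[ad b, T] = - ad (T b)\<close> and
\<open>tr (ad [a,b] \<circ> T) = - trace_form m a (T b) = 0\<close>. As \<open>y\<close> is a sum of brackets \<open>[a,b]\<close>, this gives
\<open>tr (ad y \<circ> T) = 0\<close>.\<close>

lemma ad_nilpotent_if_perfect_and_form_zero:
  assumes m: "lie_subalgebra br m" and perfect: "bracket_span br m m = m"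
    and form: "\<And>x y. x \<in> m \<Longrightarrow> y \<in> m \<Longrightarrow> trace_form m x y = 0"
    and y: "y \<in> m"
  shows "\<exists>n. \<forall>v\<in>m. (br y ^^ n) v = 0"
proof -
  have sm: "subspace m" and stab: "\<And>x. x \<in> m \<Longrightarrow> stabilizes m x"
    using m by (auto simp: lie_subalgebra_def stabilizes_def)
  obtain B where B: "rv.basis_of m B" using basis_exists[OF sm] by blast
  from endo_br[OF stab[OF y]] obtain T where T: "rv.endo_on m T"
    and der: "\<And>\<beta> u v. (\<And>x. x \<in> m \<Longrightarrow> rv.endo_on m (\<beta> x)) \<Longrightarrow> (\<And>y. y \<in> m \<Longrightarrow> rv.endo_on m (\<lambda>x. \<beta> x y)) \<Longrightarrow>
      (\<And>u v. u \<in> m \<Longrightarrow> v \<in> m \<Longrightarrow> br y (\<beta> u v) = \<beta> (br y u) v + \<beta> u (br y v)) \<Longrightarrow>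
      u \<in> m \<Longrightarrow> v \<in> m \<Longrightarrow> T (\<beta> u v) = \<beta> (T u) v + \<beta> u (T v)"
    and nil: "rv.trace_on m (\<lambda>v. br y (T v)) = 0 \<Longrightarrow> \<exists>n. \<forall>v\<in>m. (br y ^^ n) v = 0"
    by (rule conjugate_part_real[OF B]) blast
  have T_br: "T (br u v) = br (T u) v + br u (T v)" if "u \<in> m" "v \<in> m" for u v
  proof (rule der[of br, OF endo_br[OF stab] _ br_derivation that])
    show "rv.endo_on m (\<lambda>x. br x y)" if "y \<in> m" for y
      using that stab by (intro rv.endo_onI) (auto simp: br_simps stabilizes_def)
  qed
  have "stabilizes m s \<and> rv.trace_on m (\<lambda>v. br s (T v)) = 0" if s: "s \<in> {br a b | a b. a \<in> m \<and> b \<in> m}" for s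
  proof -
    obtain a b where ab: "s = br a b" "a \<in> m" "b \<in> m" using s by blast
    note Tb = rv.endo_on_mem[OF T ab(3)]
    note a = endo_br[OF stab[OF ab(2)]] and b = endo_br[OF stab[OF ab(3)]]
    have e: "rv.endo_on m (\<lambda>v. br a (br (T b) v))"
      by (rule rv.endo_on_comp[OF a endo_br[OF stab[OF Tb]]])
    have "rv.trace_on m (\<lambda>v. br s (T v)) = rv.trace_on m (\<lambda>v. br a (br b (T v) - T (br b v)))"
      unfolding ab(1) by (rule trace_br_commutator[OF B T stab[OF ab(2)] stab[OF ab(3)]])
    also have "\<dots> = rv.trace_on m (\<lambda>v. (\<lambda>_. 0) v - br a (br (T b) v))"
    proof (rule rv.trace_on_cong[OF B])
      show "rv.endo_on m (\<lambda>v. br a (br b (T v) - T (br b v)))"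
        by (rule rv.endo_on_comp[OF a rv.endo_on_diff_fun[OF
              rv.endo_on_comp[OF b T] rv.endo_on_comp[OF T b] sm]])
      show "br a (br b (T v) - T (br b v)) = 0 - br a (br (T b) v)" if "v \<in> m" for v
        using T_br[OF ab(3) that] by (simp add: br_simps)
    qed
    also have "\<dots> = rv.trace_on m (\<lambda>_. 0) - rv.trace_on m (\<lambda>v. br a (br (T b) v))"
      by (rule rv.trace_on_diff[OF B _ e]) (simp add: rv.endo_on_def subspace_0[OF sm])
    also have "\<dots> = 0"
      using form[OF ab(2) Tb] rv.trace_on_zero[OF B] by (simp add: trace_form_def)
    finally show ?thesis using stab ab m by (simp add: lie_subalgebra_def)
  qed
  moreover have "y \<in> span {br a b | a b. a \<in> m \<and> b \<in> m}" using y perfect by (simp add: bracket_span_def)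
  ultimately have "rv.trace_on m (\<lambda>v. br y (T v)) = 0" using trace_br_span_zero[OF B T] by blast
  then show ?thesis by (rule nil)
qed

end

section \<open>Minimal ideals of symplectic Lie algebras\<close>

context symplectic_lie_algebra
begin

lemmas form_simps = bilinear_ladd[OF bilinear_form] bilinear_radd[OF bilinear_form]
  bilinear_lsub[OF bilinear_form] bilinear_rsub[OF bilinear_form]
  bilinear_lmul[OF bilinear_form] bilinear_rmul[OF bilinear_form]
  bilinear_lzero[OF bilinear_form] bilinear_rzero[OF bilinear_form]
  bilinear_lneg[OF bilinear_form] bilinear_rneg[OF bilinear_form]

text \<open>For \<open>H\<close> a proper subalgebra this is a statement about the symplectic Lie algebra \<open>(H, \<omega>)\<close>; it is
used both for the whole algebra and for the complement of an abelian ideal.\<close>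

theorem minimal_ideal_abelian:
  assumes H: "lie_subalgebra br H" and nondeg: "nondegenerate_on \<omega> H" and m: "minimal_ideal_in H m"
  shows "lie_abelian br m"
proof (rule ccontr)
  assume nonabelian: "\<not> lie_abelian br m"
  have ideal: "ideal_in H m" and nonzero: "m \<noteq> {0}"
    and minimal: "\<And>I. ideal_in H I \<Longrightarrow> I \<subseteq> m \<Longrightarrow> I = {0} \<or> I = m"
    using m by (auto simp: minimal_ideal_in_def)
  have sm: "subspace m" and mH: "m \<subseteq> H" and Hm: "\<And>x y. x \<in> H \<Longrightarrow> y \<in> m \<Longrightarrow> br x y \<in> m"
    using ideal by (auto simp: ideal_in_def)
  have sH: "subspace H" using H by (simp add: lie_subalgebra_def)
  have m_sub: "lie_subalgebra br m" using sm mH Hm by (auto simp: lie_subalgebra_def)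
  have stab: "stabilizes m x" if "x \<in> H" for x using that Hm by (simp add: stabilizes_def)
  note stab_m = stab[OF subsetD[OF mH]]
  have m0: "0 \<in> m" using sm by (rule subspace_0)
  obtain B where B: "rv.basis_of m B" using basis_exists[OF sm] by blast
  let ?K = "trace_form m"
  have perfect: "bracket_span br m m = m"
  proof -
    have "bracket_span br m m \<subseteq> m" using Hm mH by (intro bracket_span_subset[OF sm]) auto
    then have "bracket_span br m m = {0} \<or> bracket_span br m m = m"
      by (intro minimal bracket_span_ideal ideal)
    moreover have "bracket_span br m m \<noteq> {0}"
      using nonabelian br_in_bracket_span[of _ m _ m] by (auto simp: lie_abelian_def)
    ultimately show ?thesis by blast
  qed
  \<comment> \<open>Otherwise Engel's theorem gives \<open>m\<close> a nonzero center, which is an ideal of \<open>H\<close>.\<close>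
  have not_zero: "\<exists>x\<in>m. \<exists>y\<in>m. ?K x y \<noteq> 0"
  proof (rule ccontr)
    assume "\<not> ?thesis"
    then have nil: "\<exists>n. \<forall>v\<in>m. (br y ^^ n) v = 0" if "y \<in> m" for y
      using ad_nilpotent_if_perfect_and_form_zero[OF m_sub perfect _ that] by blast
    have "\<exists>w\<in>m - {0}. \<forall>x\<in>m. br x w \<in> {0}"
    proof (rule engel[OF m_sub nil])
      show "\<exists>n. (br x ^^ n) w \<in> {0}" if "x \<in> m" "w \<in> m" for x w using nil that by blast
    qed (use sm nonzero m0 m_sub in \<open>auto simp: br_simps lie_subalgebra_def\<close>)
    then obtain w where w: "w \<in> m" "w \<noteq> 0" "\<And>x. x \<in> m \<Longrightarrow> br x w = 0" by auto
    let ?Z = "{z \<in> m. \<forall>x\<in>m. br x z = 0}"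
    have "ideal_in H ?Z"
      unfolding ideal_in_def
    proof (intro conjI ballI)
      show "subspace ?Z" using sm by (auto simp: subspace_def br_simps)
      fix h z assume h: "h \<in> H" and z: "z \<in> ?Z"
      have "br x (br h z) = 0" if "x \<in> m" for x
      proof -
        have "br x h \<in> m" using Hm[OF h that] br_flip[of x h] subspace_neg[OF sm] by simp
        then show ?thesis using z that by (simp add: br_derivation[of x h z] br_simps)
      qed
      then show "br h z \<in> ?Z" using Hm h z by auto
    qed (use mH in auto)
    then have "?Z = m" using minimal[of ?Z] w by blast
    then show False using nonabelian by (auto simp: lie_abelian_def)
  qed
  \<comment> \<open>The radical of the trace form on \<open>m\<close> is an ideal of \<open>H\<close>.\<close>
  have form_nondeg: "x = 0" if x: "x \<in> m" "\<And>y. y \<in> m \<Longrightarrow> ?K x y = 0" for x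
  proof -
    let ?R = "{x \<in> m. \<forall>y\<in>m. ?K x y = 0}"
    have "ideal_in H ?R"
      unfolding ideal_in_def
    proof (intro conjI ballI)
      have K0: "?K 0 y = 0" if "y \<in> m" for y
        using trace_form_left[OF sm stab_m[OF m0] stab_m[OF m0] stab_m[OF that], of 1] by simp
      show "subspace ?R"
      proof (rule subspaceI)
        show "x + y \<in> ?R" if "x \<in> ?R" "y \<in> ?R" for x y
          using that trace_form_left[OF sm stab_m stab_m stab_m, of x y _ 1] subspace_add[OF sm] by auto
        show "c *\<^sub>R x \<in> ?R" if "x \<in> ?R" for c x
          using that trace_form_left[OF sm stab_m stab_m stab_m, of x 0 _ c] subspace_scale[OF sm] m0 K0 by auto
      qed (use K0 m0 in auto)
      fix h x assume h: "h \<in> H" and x: "x \<in> ?R"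
      have "?K (br h x) y = 0" if "y \<in> m" for y
      proof -
        have "?K (br x h) y = ?K x (br h y)"
          using x that by (intro trace_form_invariant sm stab h subsetD[OF mH]) auto
        also have "\<dots> = 0" using x Hm[OF h that] by blast
        finally have "?K (br x h) y = 0" .
        moreover have "br h x = (-1) *\<^sub>R br x h + 0" using br_flip[of h x] by simp
        moreover have "br x h \<in> m" using Hm[OF h, of x] x br_flip[of x h] subspace_neg[OF sm] by simp
        ultimately show ?thesis
          using trace_form_left[OF sm stab_m stab_m[OF m0] stab_m[OF that], of "br x h" "-1"] K0[OF that] by simp
      qed
      then show "br h x \<in> ?R" using Hm h x by auto
    qed (use mH in auto)
    then have "?R = {0}" using minimal[of ?R] not_zero by blast
    then show ?thesis using x by blast
  qed
  have represents: "\<exists>x\<in>m. \<forall>y\<in>m. ?K x y = \<phi> y"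
    if "\<And>c y y'. y \<in> m \<Longrightarrow> y' \<in> m \<Longrightarrow> \<phi> (c *\<^sub>R y + y') = c * \<phi> y + \<phi> y'" for \<phi>
    by (rule form_represents[OF B])
       (use that form_nondeg trace_form_left[OF sm] trace_form_right[OF sm] stab_m in auto)
  \<comment> \<open>Hence \<open>H\<close> is the sum of \<open>m\<close> and the centralizer of \<open>m\<close>.\<close>
  have inner: "\<exists>x\<in>m. \<forall>v\<in>m. br (h - x) v = 0" if h: "h \<in> H" for h
  proof -
    obtain x where x: "x \<in> m" "\<And>y. y \<in> m \<Longrightarrow> ?K x y = ?K h y"
      using represents[of "?K h"] trace_form_right[OF sm stab[OF h]] stab_m by blast
    have hx: "h - x \<in> H" using h x(1) mH subspace_diff[OF sH] by blast
    have 0: "?K (h - x) y = 0" if "y \<in> m" for y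
      using trace_form_left[OF sm stab_m[OF x(1)] stab[OF h] stab_m[OF that], of "-1"] x(2)[OF that] by simp
    have "br (h - x) v = 0" if v: "v \<in> m" for v
    proof (rule form_nondeg)
      show "br (h - x) v \<in> m" using Hm hx v by blast
      fix z assume z: "z \<in> m"
      have "?K (br (h - x) v) z = ?K (h - x) (br v z)"
        by (intro trace_form_invariant sm stab stab_m hx v z)
      also have "\<dots> = 0" using 0 Hm v z mH by blast
      finally show "?K (br (h - x) v) z = 0" .
    qed
    then show ?thesis using x(1) by blast
  qed
  have centralizer_orthogonal: "\<omega> e y = 0" if e: "\<And>v. v \<in> m \<Longrightarrow> br e v = 0" and y: "y \<in> m" for e y
  proof -
    have "bracket_span br m m \<subseteq> {y. \<omega> e y = 0}"
    proof (rule bracket_span_subset)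
      show "subspace {y. \<omega> e y = 0}" by (auto simp: subspace_def form_simps)
      fix a b assume ab: "a \<in> m" "b \<in> m"
      have "br b e = 0" using e[OF ab(2)] br_flip[of b e] by simp
      then have "\<omega> (br a b) e = 0" using closed[of a b e] e[OF ab(1)] by (simp add: form_simps)
      then show "br a b \<in> {y. \<omega> e y = 0}" using skew[of e "br a b"] by simp
    qed
    then show ?thesis using y perfect by blast
  qed
  have \<omega>_nondeg: "x = 0" if x: "x \<in> m" "\<And>y. y \<in> m \<Longrightarrow> \<omega> x y = 0" for x
  proof -
    have "\<omega> x h = 0" if h: "h \<in> H" for h
    proof -
      obtain u where u: "u \<in> m" "\<forall>v\<in>m. br (h - u) v = 0" using inner[OF h] by blast
      have "\<omega> (h - u) x = 0" by (rule centralizer_orthogonal) (use u x in auto)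
      then have "\<omega> x (h - u) = 0" using skew[of x "h - u"] by simp
      then show ?thesis using x(2)[OF u(1)] by (simp add: form_simps)
    qed
    then have "x \<in> H \<inter> perp \<omega> H" using x(1) mH by (auto simp: perp_def)
    then show ?thesis using nondeg unfolding nondegenerate_on_def by blast
  qed
  have "\<forall>x\<in>m. \<exists>d\<in>m. \<forall>y\<in>m. ?K d y = \<omega> x y"
    using represents by (simp add: form_simps)
  then obtain D where D: "\<And>x. x \<in> m \<Longrightarrow> D x \<in> m" "\<And>x y. x \<in> m \<Longrightarrow> y \<in> m \<Longrightarrow> ?K (D x) y = \<omega> x y"
    by metis
  have unique: "x = x'" if "x \<in> m" "x' \<in> m" "\<And>y. y \<in> m \<Longrightarrow> ?K x y = ?K x' y" for x x'
  proof -
    have "(-1) *\<^sub>R x' + x = 0"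
      using that trace_form_left[OF sm stab_m[OF that(2)] stab_m[OF that(1)] stab_m, of _ "-1"]
        subspace_diff[OF sm] by (intro form_nondeg) auto
    then show ?thesis by simp
  qed
  have D_lin: "D (c *\<^sub>R x + x') = c *\<^sub>R D x + D x'" if "x \<in> m" "x' \<in> m" for c x x'
  proof (rule unique)
    show "D (c *\<^sub>R x + x') \<in> m" "c *\<^sub>R D x + D x' \<in> m"
      using that D(1) sm by (auto simp: subspace_add subspace_scale)
    fix y assume y: "y \<in> m"
    have "c *\<^sub>R x + x' \<in> m" using that sm by (simp add: subspace_add subspace_scale)
    then show "?K (D (c *\<^sub>R x + x')) y = ?K (c *\<^sub>R D x + D x') y"
      using trace_form_left[OF sm stab_m[OF D(1)] stab_m[OF D(1)] stab_m[OF y], OF that]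
      by (simp add: D(2) that y form_simps)
  qed
  have D0: "D 0 = 0" using D_lin[OF m0 m0, of 1] by simp
  have D_endo: "rv.endo_on m D"
    using D(1) D_lin[of _ _ 1] D_lin[OF _ m0] D0 by (intro rv.endo_onI) auto
  \<comment> \<open>For a form written as \<open>K(D x, y)\<close>, the cocycle identity is the Leibniz rule for \<open>D\<close>.\<close>
  have D_der: "D (br x y) = br (D x) y + br x (D y)" if xy: "x \<in> m" "y \<in> m" for x y
  proof (rule unique)
    have mem: "br x y \<in> m" "br (D x) y \<in> m" "br (D y) x \<in> m" "br x (D y) \<in> m"
      using xy D(1) Hm mH by blast+
    show "D (br x y) \<in> m" "br (D x) y + br x (D y) \<in> m" using mem D(1) sm by (auto simp: subspace_add)
    fix z assume z: "z \<in> m"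
    have yz: "br y z \<in> m" "br x z \<in> m" using xy z Hm mH by blast+
    have eq: "br (D x) y + br x (D y) = (-1) *\<^sub>R br (D y) x + br (D x) y"
      by (subst br_flip[of x "D y"]) simp
    have "?K (br (D x) y + br x (D y)) z = ?K (br (D x) y) z - ?K (br (D y) x) z"
      unfolding eq trace_form_left[OF sm stab_m[OF mem(3)] stab_m[OF mem(2)] stab_m[OF z]] by simp
    also have "\<dots> = ?K (D x) (br y z) - ?K (D y) (br x z)"
      using trace_form_invariant[OF sm] stab_m D(1) xy z by simp
    also have "\<dots> = \<omega> x (br y z) - \<omega> y (br x z)" using D(2) xy yz by simp
    also have "\<dots> = \<omega> (br x y) z"
    proof -
      have "\<omega> (br z x) y = \<omega> y (br x z)"
        unfolding br_flip[of z x] by (simp add: form_simps skew[of y])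
      then show ?thesis using closed[of x y z] skew[of x "br y z"] by simp
    qed
    also have "\<dots> = ?K (D (br x y)) z" using D(2) mem z by simp
    finally show "?K (D (br x y)) z = ?K (br (D x) y + br x (D y)) z" by simp
  qed
  \<comment> \<open>The derivation \<open>D\<close> is inner: choose \<open>u\<close> so that \<open>E = D - ad u\<close> is trace-orthogonal to all
      \<open>ad y\<close>; then \<open>K(E y, z) = tr ([E, ad y] \<circ> ad z) = tr (E \<circ> ad [y,z]) = 0\<close>.\<close>
  have "\<exists>u\<in>m. \<forall>y\<in>m. ?K u y = rv.trace_on m (\<lambda>v. br y (D v))"
    by (rule represents) (intro trace_br_lincomb[OF B D_endo] stab_m)
  then obtain u where u: "u \<in> m" "\<And>y. y \<in> m \<Longrightarrow> ?K u y = rv.trace_on m (\<lambda>v. br y (D v))"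
    by blast
  define E where "E v = D v - br u v" for v
  have E_endo: "rv.endo_on m E"
    unfolding E_def by (rule rv.endo_on_diff_fun[OF D_endo endo_br[OF stab_m[OF u(1)]] sm])
  have E_der: "E (br x y) = br (E x) y + br x (E y)" if "x \<in> m" "y \<in> m" for x y
    using D_der[OF that] br_derivation[of u x y] by (simp add: E_def br_simps)
  have E_trace: "rv.trace_on m (\<lambda>v. E (br y v)) = 0" if y: "y \<in> m" for y
  proof -
    note ad_u = endo_br[OF stab_m[OF u(1)]] and ad_y = endo_br[OF stab_m[OF y]]
    have "rv.trace_on m (\<lambda>v. E (br y v))
        = rv.trace_on m (\<lambda>v. D (br y v)) - rv.trace_on m (\<lambda>v. br u (br y v))"
      unfolding E_def
      by (rule rv.trace_on_diff[OF B rv.endo_on_comp[OF D_endo ad_y] rv.endo_on_comp[OF ad_u ad_y]])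
    also have "rv.trace_on m (\<lambda>v. D (br y v)) = rv.trace_on m (\<lambda>v. br y (D v))"
      by (rule rv.trace_on_comm[OF B D_endo ad_y])
    finally show ?thesis using u(2)[OF y] by (simp add: trace_form_def)
  qed
  have E_zero: "E y = 0" if y: "y \<in> m" for y
  proof (rule form_nondeg)
    show "E y \<in> m" using rv.endo_on_mem[OF E_endo y] .
    fix z assume z: "z \<in> m"
    note ad_y = endo_br[OF stab_m[OF y]] and ad_z = endo_br[OF stab_m[OF z]]
    note Ez = rv.endo_on_comp[OF E_endo ad_z]
    have "?K (E y) z = rv.trace_on m (\<lambda>v. E (br y (br z v)) - br y (E (br z v)))"
      unfolding trace_form_def
      by (rule rv.trace_on_cong[OF B rv.endo_on_comp[OF endo_br[OF stab_m[OF \<open>E y \<in> m\<close>]] ad_z]])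
         (simp add: E_der[OF y] Hm[OF subsetD[OF mH z]])
    also have "\<dots> = rv.trace_on m (\<lambda>v. E (br y (br z v))) - rv.trace_on m (\<lambda>v. br y (E (br z v)))"
      by (rule rv.trace_on_diff[OF B rv.endo_on_comp[OF E_endo rv.endo_on_comp[OF ad_y ad_z]] rv.endo_on_comp[OF ad_y Ez]])
    also have "rv.trace_on m (\<lambda>v. br y (E (br z v))) = rv.trace_on m (\<lambda>v. E (br z (br y v)))"
      by (rule rv.trace_on_comm[OF B ad_y Ez])
    also have "rv.trace_on m (\<lambda>v. E (br y (br z v))) - rv.trace_on m (\<lambda>v. E (br z (br y v)))
        = rv.trace_on m (\<lambda>v. E (br y (br z v)) - E (br z (br y v)))"
      by (rule rv.trace_on_diff[OF B rv.endo_on_comp[OF E_endo rv.endo_on_comp[OF ad_y ad_z]]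
            rv.endo_on_comp[OF E_endo rv.endo_on_comp[OF ad_z ad_y]], symmetric])
    also have "\<dots> = rv.trace_on m (\<lambda>v. E (br (br y z) v))"
    proof (rule rv.trace_on_cong[OF B, symmetric])
      have yz: "br y z \<in> m" using y z Hm mH by blast
      then show "rv.endo_on m (\<lambda>v. E (br (br y z) v))" by (rule rv.endo_on_comp[OF E_endo endo_br[OF stab_m]])
      fix v assume v: "v \<in> m"
      show "E (br (br y z) v) = E (br y (br z v)) - E (br z (br y v))"
        unfolding br_br_left using v y z Hm mH by (intro rv.endo_on_diff[OF E_endo sm]) blast+
    qed
    also have "\<dots> = 0" using y z Hm mH by (intro E_trace) blast
    finally show "?K (E y) z = 0" .
  qed
  have K0: "?K 0 y = 0" if "y \<in> m" for y
    using trace_form_left[OF sm stab_m[OF m0] stab_m[OF m0] stab_m[OF that], of 1] by simp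
  \<comment> \<open>Now \<open>D = ad u\<close>, and \<open>D u = [u,u] = 0\<close> says that \<open>u\<close> lies in the radical of \<open>\<omega>\<close> on \<open>m\<close>.\<close>
  have "D u = 0" using E_zero[OF u(1)] by (simp add: E_def br_self)
  then have "\<omega> u y = 0" if "y \<in> m" for y using D(2)[OF u(1) that] K0[OF that] by simp
  then have "u = 0" using \<omega>_nondeg[OF u(1)] by blast
  then have "D x = 0" if "x \<in> m" for x using E_zero[OF that] by (simp add: E_def br_simps)
  then have "\<omega> x y = 0" if "x \<in> m" "y \<in> m" for x y using D(2)[OF that] K0[OF that(2)] that(1) by simp
  then have "m = {0}" using \<omega>_nondeg m0 by blast
  then show False using nonzero by blast
qed

section \<open>Orthogonal complements and skew maps\<close>

lemma subspace_perp: "subspace (perp \<omega> M)"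
  by (auto simp: subspace_def perp_def form_simps)

lemma perp_flip: "x \<in> perp \<omega> M \<Longrightarrow> y \<in> M \<Longrightarrow> \<omega> y x = 0"
  using skew[of y x] by (simp add: perp_def)

lemma nondegenerate_decomposition:
  assumes "subspace M" "nondegenerate_on \<omega> M"
  shows "\<exists>u\<in>M. x - u \<in> perp \<omega> M"
proof -
  obtain B where B: "rv.basis_of M B" using basis_exists[OF assms(1)] by blast
  have "\<exists>u\<in>M. \<forall>y\<in>M. \<omega> u y = \<omega> x y"
  proof (rule form_represents[OF B])
    show "u = 0" if "u \<in> M" "\<And>y. y \<in> M \<Longrightarrow> \<omega> u y = 0" for u
      using assms(2) that by (auto simp: nondegenerate_on_def perp_def)
  qed (simp_all add: form_simps)
  then obtain u where "u \<in> M" "\<forall>y\<in>M. \<omega> u y = \<omega> x y" by blast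
  then have "u \<in> M \<and> x - u \<in> perp \<omega> M" by (simp add: perp_def form_simps)
  then show ?thesis by blast
qed

lemma nondegenerate_perp:
  assumes "subspace M" "nondegenerate_on \<omega> M"
  shows "nondegenerate_on \<omega> (perp \<omega> M)"
proof -
  have "x = 0" if x: "x \<in> perp \<omega> M" "x \<in> perp \<omega> (perp \<omega> M)" for x
  proof (rule nondegenerate)
    fix y
    obtain u where u: "u \<in> M" "y - u \<in> perp \<omega> M" using nondegenerate_decomposition[OF assms] by blast
    have "\<omega> x (u + (y - u)) = \<omega> x u + \<omega> x (y - u)" by (rule bilinear_radd[OF bilinear_form])
    then show "\<omega> x y = 0" using x u by (simp add: perp_def)
  qed
  then show ?thesis
    using subspace_0[OF subspace_perp] unfolding nondegenerate_on_def by blast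
qed

lemma perp_ideal_subalgebra:
  assumes "lie_ideal br I"
  shows "lie_subalgebra br (perp \<omega> I)"
proof -
  have "\<omega> (br x y) z = 0" if x: "x \<in> perp \<omega> I" and y: "y \<in> perp \<omega> I" and z: "z \<in> I" for x y z
  proof -
    have "br y z \<in> I" "br x z \<in> I" using assms z by (auto simp: lie_ideal_def)
    then have "\<omega> (br y z) x = 0" "\<omega> (br x z) y = 0" using x y by (auto intro: perp_flip)
    then show ?thesis using closed[of x y z] br_flip[of z x] by (simp add: form_simps)
  qed
  then show ?thesis using subspace_perp by (auto simp: lie_subalgebra_def perp_def)
qed

lemma perp_acts_skew:
  assumes "lie_abelian br I" "h \<in> perp \<omega> I" "x \<in> I" "y \<in> I"
  shows "\<omega> (br h x) y = - \<omega> x (br h y)"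
proof -
  have "br x y = 0" using assms by (simp add: lie_abelian_def)
  then show ?thesis
    using closed[of h x y] br_flip[of y h] skew[of x "br h y"] by (simp add: form_simps)
qed

text \<open>Let \<open>c\<close> be the basis dual to \<open>B\<close> with respect to \<open>\<omega>\<close>. The trace of \<open>f\<close> is the contraction of
\<open>\<omega> (f b) d\<close>, which is symmetric in \<open>b, d\<close>, with \<open>\<omega> (c b) (c d)\<close>, which is antisymmetric.\<close>

lemma trace_skew_zero:
  assumes f: "linear f" and skew_f: "\<And>x y. \<omega> (f x) y = - \<omega> x (f y)"
  shows "lin_trace f = 0"
proof -
  obtain B where B: "rv.basis_of (UNIV :: 'a set) B" using basis_exists[OF subspace_UNIV] by blast
  have B': "finite B" "independent B" "span B = UNIV" using B by (auto simp: rv.basis_of_def)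
  have lin_r: "linear (\<omega> x)" and lin_l: "linear (\<lambda>y. \<omega> y x)" for x
    using bilinear_form by (auto simp: bilinear_def)
  have "\<forall>b. \<exists>c. \<forall>y. \<omega> c y = representation B y b"
  proof
    fix b
    have "\<exists>c\<in>UNIV. \<forall>y\<in>UNIV. \<omega> c y = representation B y b"
      by (rule form_represents[OF B])
         (use nondegenerate B' in \<open>auto simp: form_simps representation_add representation_scale\<close>)
    then show "\<exists>c. \<forall>y. \<omega> c y = representation B y b" by simp
  qed
  then obtain c where c: "\<And>b y. \<omega> (c b) y = representation B y b" by metis
  have expand: "z = (\<Sum>b\<in>B. \<omega> z b *\<^sub>R c b)" for z
  proof -
    have "\<omega> (z - (\<Sum>b\<in>B. \<omega> z b *\<^sub>R c b)) y = 0" for y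
    proof -
      have "\<omega> (\<Sum>b\<in>B. \<omega> z b *\<^sub>R c b) y = (\<Sum>b\<in>B. representation B y b * \<omega> z b)"
        by (simp add: linear_sum[OF lin_l] form_simps c mult.commute)
      also have "\<dots> = \<omega> z (\<Sum>b\<in>B. representation B y b *\<^sub>R b)"
        by (simp add: linear_sum[OF lin_r] form_simps)
      also have "\<dots> = \<omega> z y" using rv.basis_of_expand[OF B, of y] by simp
      finally show ?thesis by (simp add: form_simps)
    qed
    then show ?thesis using nondegenerate[of "z - (\<Sum>b\<in>B. \<omega> z b *\<^sub>R c b)"] by simp
  qed
  define S where "S = (\<Sum>b\<in>B. \<Sum>d\<in>B. \<omega> (f b) d * \<omega> (c b) (c d))"
  have "lin_trace f = (\<Sum>b\<in>B. \<omega> (c b) (f b))" using lin_trace_eq[OF f B'] by (simp add: c)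
  also have "\<dots> = S"
    unfolding S_def
    by (rule sum.cong[OF refl], subst expand) (simp add: linear_sum[OF lin_r] form_simps)
  finally have "lin_trace f = S" .
  have "S = (\<Sum>d\<in>B. \<Sum>b\<in>B. \<omega> (f b) d * \<omega> (c b) (c d))" unfolding S_def by (rule sum.swap)
  also have "\<dots> = (\<Sum>d\<in>B. \<Sum>b\<in>B. - (\<omega> (f d) b * \<omega> (c d) (c b)))"
  proof (intro sum.cong refl)
    fix b d
    have "\<omega> (f b) d = \<omega> (f d) b" using skew_f[of b d] skew[of b "f d"] by simp
    then show "\<omega> (f b) d * \<omega> (c b) (c d) = - (\<omega> (f d) b * \<omega> (c d) (c b))" using skew[of "c b" "c d"] by simp
  qed
  also have "\<dots> = - S" by (simp add: S_def sum_negf)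
  finally show ?thesis using \<open>lin_trace f = S\<close> by simp
qed

lemma lin_trace_br_eq: "lin_trace (br x) = rv.trace_on UNIV (br x)"
proof -
  obtain B where B: "rv.basis_of (UNIV :: 'a set) B" using basis_exists[OF subspace_UNIV] by blast
  have "linear (br x)" using bilinear_br by (simp add: bilinear_def)
  then show ?thesis
    using lin_trace_eq[of "br x" B] rv.trace_on_eq[OF B endo_br] B
    by (simp add: rv.basis_of_def stabilizes_def)
qed

lemma lin_trace_br_commutators:
  assumes "d \<in> bracket_span br UNIV UNIV"
  shows "lin_trace (br d) = 0"
proof -
  obtain B where B: "rv.basis_of (UNIV :: 'a set) B" using basis_exists[OF subspace_UNIV] by blast
  have stab: "stabilizes UNIV x" for x by (simp add: stabilizes_def)
  have id: "rv.endo_on UNIV (\<lambda>v. v)" by (simp add: rv.endo_on_def)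
  have "rv.trace_on UNIV (br s) = 0" if "s \<in> {br x y | x y. x \<in> UNIV \<and> y \<in> UNIV}" for s
    using that trace_br_commutator[OF B id stab stab] rv.trace_on_zero[OF B] by (auto simp: br_simps)
  then show ?thesis
    using trace_br_span_zero[OF B id, of "{br x y | x y. x \<in> UNIV \<and> y \<in> UNIV}" d] assms stab
    by (auto simp: lin_trace_br_eq bracket_span_def)
qed

end

section \<open>Irreducible symplectic Lie algebras\<close>

locale irreducible_symplectic_lie_algebra = symplectic_lie_algebra +
  assumes irreducible: "symplectically_irreducible br \<omega>"
begin

text \<open>For \<open>y\<close> in \<open>I \<inter> I\<^sup>\<bottom>\<close> and \<open>z\<close> in \<open>I\<close>, closedness reads \<open>\<omega> [x,y] z = \<omega> [x,z] y - \<omega> [y,z] x\<close>. The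
first term vanishes because \<open>I\<close> is an ideal and the second because \<open>I\<close> is abelian; so the radical
\<open>I \<inter> I\<^sup>\<bottom>\<close> is an isotropic ideal.\<close>

lemma abelian_ideal_nondegenerate:
  assumes ideal: "lie_ideal br I" and abelian: "lie_abelian br I"
  shows "nondegenerate_on \<omega> I"
proof -
  let ?J = "I \<inter> perp \<omega> I"
  have I: "subspace I" "\<And>x y. y \<in> I \<Longrightarrow> br x y \<in> I" using ideal by (auto simp: lie_ideal_def)
  have "br x y \<in> ?J" if y: "y \<in> ?J" for x y
  proof -
    have "\<omega> (br x y) z = 0" if z: "z \<in> I" for z
    proof -
      have "\<omega> (br x z) y = 0" using y I(2)[OF z] by (auto intro: perp_flip)
      moreover have "br y z = 0" using abelian y z by (simp add: lie_abelian_def)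
      ultimately show ?thesis using closed[of x y z] br_flip[of z x] by (simp add: form_simps)
    qed
    then show ?thesis using I(2) y by (auto simp: perp_def)
  qed
  then have "lie_ideal br ?J"
    using subspace_inter[OF I(1) subspace_perp] by (simp add: lie_ideal_def)
  moreover have "isotropic \<omega> ?J" by (auto simp: isotropic_def perp_def)
  ultimately show ?thesis
    using irreducible unfolding symplectically_irreducible_def nondegenerate_on_def by blast
qed

text \<open>The line spanned by a central vector is an isotropic ideal.\<close>

lemma center_trivial:
  assumes "\<And>x. br x z = 0"
  shows "z = 0"
proof -
  have zero: "v \<in> span {z} \<Longrightarrow> br x v = 0" for x v
    using assms by (auto simp: span_singleton br_simps)
  have "\<omega> z z = 0" using skew[of z z] by simp
  then have "isotropic \<omega> (span {z})" by (auto simp: isotropic_def perp_def span_singleton form_simps)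
  moreover have "lie_ideal br (span {z})" using zero by (simp add: lie_ideal_def span_zero)
  ultimately have "span {z} = {0}" using irreducible unfolding symplectically_irreducible_def by blast
  then show ?thesis using span_base[of z "{z}"] by simp
qed

lemma maximal_abelian_ideal_exists: "\<exists>I. maximal_abelian_ideal br I"
proof -
  let ?P = "\<lambda>I. lie_ideal br I \<and> lie_abelian br I"
  have sub: "subspace I" if "?P I" for I using that by (simp add: lie_ideal_def)
  have "?P {0}" by (simp add: lie_ideal_def lie_abelian_def br_simps)
  moreover have "\<forall>I. ?P I \<longrightarrow> dim I < Suc (dim (UNIV :: 'a set))"
    using dim_strict_mono[OF sub subspace_UNIV] by (metis less_SucI lessI psubsetI top_greatest)
  ultimately obtain I where I: "?P I" "\<And>J. ?P J \<Longrightarrow> dim J \<le> dim I"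
    using ex_has_greatest_nat[of ?P "{0}" dim "Suc (dim (UNIV :: 'a set))"] by (metis (lifting) less_imp_le)
  have "J = I" if "?P J" "I \<subseteq> J" for J
  proof (rule ccontr)
    assume "J \<noteq> I"
    then have "dim I < dim J" using that by (intro dim_strict_mono[OF sub[OF I(1)] sub[OF that(1)]]) auto
    then show False using I(2)[OF that(1)] by simp
  qed
  then show ?thesis using I(1) unfolding maximal_abelian_ideal_def by blast
qed

context
  fixes I :: "'a set"
  assumes I_max: "maximal_abelian_ideal br I"
begin

private lemma I_ideal: "lie_ideal br I" and I_abelian: "lie_abelian br I"
  using I_max by (auto simp: maximal_abelian_ideal_def)

private lemma I_subspace: "subspace I" and I_br: "y \<in> I \<Longrightarrow> br x y \<in> I"
  using I_ideal by (auto simp: lie_ideal_def)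

private lemma I_nondegenerate: "nondegenerate_on \<omega> I"
  by (rule abelian_ideal_nondegenerate[OF I_ideal I_abelian])

private lemma split:
  obtains u h where "u \<in> I" "h \<in> perp \<omega> I" "x = u + h"
proof -
  obtain u where u: "u \<in> I" "x - u \<in> perp \<omega> I"
    using nondegenerate_decomposition[OF I_subspace I_nondegenerate] by blast
  then show thesis by (intro that[of u "x - u"]) auto
qed

private lemma I_perp_subalgebra: "lie_subalgebra br (perp \<omega> I)"
  by (rule perp_ideal_subalgebra[OF I_ideal])

private lemma I_perp_br: "x \<in> perp \<omega> I \<Longrightarrow> y \<in> perp \<omega> I \<Longrightarrow> br x y \<in> perp \<omega> I"
  using I_perp_subalgebra by (simp add: lie_subalgebra_def)

text \<open>The abelian ideal \<open>I\<close> acts trivially on itself, so only the action of its complement matters.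
Together with nondegeneracy of abelian ideals, this makes the \<open>I\<^sup>\<bottom>\<close>-module \<open>I\<close> completely reducible
with nondegenerate submodules.\<close>

private lemma submodule_ideal:
  assumes "subspace W" "W \<subseteq> I" "\<And>h w. h \<in> perp \<omega> I \<Longrightarrow> w \<in> W \<Longrightarrow> br h w \<in> W"
  shows "lie_ideal br W" and "lie_abelian br W"
proof -
  have "br x w \<in> W" if w: "w \<in> W" for x w
  proof -
    obtain u h where x: "u \<in> I" "h \<in> perp \<omega> I" "x = u + h" using split by blast
    have "br u w = 0" using I_abelian x(1) w assms(2) by (auto simp: lie_abelian_def)
    then show ?thesis using assms(3)[OF x(2) w] by (simp add: x(3) br_simps)
  qed
  then show "lie_ideal br W" using assms(1) by (simp add: lie_ideal_def)
  show "lie_abelian br W" using I_abelian assms(2) by (auto simp: lie_abelian_def)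
qed

text \<open>The kernel \<open>k\<close> of the action is an ideal of the whole algebra. A minimal ideal \<open>m \<subseteq> k\<close> is abelian and
commutes with \<open>I\<close>, so \<open>I + m\<close> is an abelian ideal, against maximality of \<open>I\<close>.\<close>

lemma perp_acts_faithfully:
  assumes "h \<in> perp \<omega> I" "\<And>x. x \<in> I \<Longrightarrow> br h x = 0"
  shows "h = 0"
proof (rule ccontr)
  assume "h \<noteq> 0"
  let ?k = "{h \<in> perp \<omega> I. \<forall>x\<in>I. br h x = 0}"
  have "br x y \<in> ?k" if y: "y \<in> ?k" for x y
  proof -
    obtain u v where x: "u \<in> I" "v \<in> perp \<omega> I" "x = u + v" using split by blast
    have "br u y = 0" using y x(1) br_flip[of u y] by simp
    then have "br x y = br v y" by (simp add: x(3) br_simps)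
    moreover have "br (br v y) z = 0" if "z \<in> I" for z
      using y that I_br[OF that] by (simp add: br_br_left br_simps)
    ultimately show ?thesis using I_perp_br[OF x(2)] y by simp
  qed
  moreover have "subspace ?k"
    using subspace_perp[of I] by (auto simp: subspace_def br_simps)
  ultimately have "ideal_in UNIV ?k" by (simp add: ideal_in_def)
  moreover have "?k \<noteq> {0}" using assms \<open>h \<noteq> 0\<close> by blast
  ultimately obtain m where m: "m \<subseteq> ?k" "minimal_ideal_in UNIV m"
    using minimal_ideal_exists[of UNIV ?k] by auto
  have "nondegenerate_on \<omega> UNIV"
    using nondegenerate by (auto simp: nondegenerate_on_def perp_def form_simps)
  then have m_abelian: "lie_abelian br m"
    using minimal_ideal_abelian[OF _ _ m(2)] by (simp add: lie_subalgebra_def)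
  have m_ideal: "subspace m" "\<And>x y. y \<in> m \<Longrightarrow> br x y \<in> m" "m \<noteq> {0}"
    using m(2) by (auto simp: minimal_ideal_in_def ideal_in_def)
  let ?J = "{u + v | u v. u \<in> I \<and> v \<in> m}"
  have "subspace ?J" by (rule subspace_sums[OF I_subspace m_ideal(1)])
  moreover have "br x w \<in> ?J" if w: "w \<in> ?J" for x w
  proof -
    obtain u v where "w = u + v" "u \<in> I" "v \<in> m" using w by blast
    moreover from this have "br x w = br x u + br x v" by (simp add: br_simps)
    ultimately show ?thesis using I_br m_ideal(2) by blast
  qed
  ultimately have "lie_ideal br ?J" by (simp add: lie_ideal_def)
  moreover have "lie_abelian br ?J"
    unfolding lie_abelian_def
  proof (intro ballI)
    fix w w' assume "w \<in> ?J" "w' \<in> ?J"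
    then obtain u v u' v' where *: "w = u + v" "u \<in> I" "v \<in> m" "w' = u' + v'" "u' \<in> I" "v' \<in> m" by blast
    have "br u u' = 0" "br v v' = 0" using * I_abelian m_abelian by (auto simp: lie_abelian_def)
    moreover have "br v u' = 0" "br v' u = 0" using * m(1) by auto
    ultimately show "br w w' = 0" using br_flip[of u v'] by (simp add: *(1,4) br_simps)
  qed
  moreover have "I \<subseteq> ?J" using subspace_0[OF m_ideal(1)] by force
  ultimately have "?J = I" using I_max unfolding maximal_abelian_ideal_def by blast
  moreover have "m \<subseteq> ?J" using subspace_0[OF I_subspace] by force
  ultimately have "m \<subseteq> I \<inter> perp \<omega> I" using m(1) by blast
  then show False
    using I_nondegenerate m_ideal(3) subspace_0[OF m_ideal(1)] by (auto simp: nondegenerate_on_def)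
qed

text \<open>A minimal ideal \<open>m\<close> of \<open>I\<^sup>\<bottom>\<close> inside the derived algebra of \<open>I\<^sup>\<bottom>\<close> acts nilpotently on \<open>I\<close>: it is
either central in \<open>I\<^sup>\<bottom>\<close>, or it is spanned by brackets \<open>[a,b]\<close> with \<open>b\<close> in the abelian ideal \<open>m\<close>; in
both cases its elements are sums of brackets \<open>[a,b]\<close> in which \<open>b\<close> commutes with the element. But a
nilpotent action with nondegenerate submodules is trivial.\<close>

lemma perp_abelian: "lie_abelian br (perp \<omega> I)"
proof (rule ccontr)
  let ?h = "perp \<omega> I"
  assume nonabelian: "\<not> lie_abelian br ?h"
  have h_ideal: "ideal_in ?h ?h" using I_perp_br subspace_perp by (simp add: ideal_in_def)
  have "bracket_span br ?h ?h \<noteq> {0}"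
    using nonabelian br_in_bracket_span[of _ ?h _ ?h] by (auto simp: lie_abelian_def)
  then obtain m where m: "m \<subseteq> bracket_span br ?h ?h" "minimal_ideal_in ?h m"
    using minimal_ideal_exists[OF bracket_span_ideal[OF h_ideal h_ideal]] by blast
  have m_abelian: "lie_abelian br m"
    by (rule minimal_ideal_abelian[OF I_perp_subalgebra nondegenerate_perp[OF I_subspace I_nondegenerate] m(2)])
  have m_ideal: "ideal_in ?h m" "m \<noteq> {0}" and m_min: "\<And>J. ideal_in ?h J \<Longrightarrow> J \<subseteq> m \<Longrightarrow> J = {0} \<or> J = m"
    using m(2) by (auto simp: minimal_ideal_in_def)
  have sm: "subspace m" and mh: "m \<subseteq> ?h" and hm: "\<And>x y. x \<in> ?h \<Longrightarrow> y \<in> m \<Longrightarrow> br x y \<in> m"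
    using m_ideal(1) by (auto simp: ideal_in_def)
  have m_sub: "lie_subalgebra br m" using sm mh hm by (auto simp: lie_subalgebra_def)
  have stab: "stabilizes I x" for x using I_br by (simp add: stabilizes_def)
  have nil: "\<exists>n. \<forall>v\<in>I. (br y ^^ n) v = 0" if y: "y \<in> m" for y
  proof (rule nilpotent_if_commutators_with_centralizer[OF I_subspace])
    let ?C = "{br a b | a b. stabilizes I a \<and> stabilizes I b \<and> (\<forall>v\<in>I. br b (br y v) = br y (br b v))}"
    have comm: "br a b \<in> ?C" if "br b y = 0" for a b
      using that stab br_derivation[of b y] by (auto simp: br_simps)
    have "ideal_in ?h (bracket_span br ?h m)" by (rule bracket_span_ideal[OF h_ideal m_ideal(1)])
    moreover have "bracket_span br ?h m \<subseteq> m" using hm by (intro bracket_span_subset sm)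
    ultimately consider "bracket_span br ?h m = {0}" | "bracket_span br ?h m = m" using m_min by blast
    then show "y \<in> span ?C"
    proof cases
      case 1
      then have "br b y = 0" if "b \<in> ?h" for b using br_in_bracket_span[OF that y] by simp
      then have "bracket_span br ?h ?h \<subseteq> span ?C"
        using comm by (intro bracket_span_subset subspace_span span_base) blast
      then show ?thesis using m(1) y by blast
    next
      case 2
      have "br b y = 0" if "b \<in> m" for b using m_abelian that y by (simp add: lie_abelian_def)
      then have "bracket_span br ?h m \<subseteq> span ?C"
        using comm by (intro bracket_span_subset subspace_span span_base) blast
      then show ?thesis using 2 y by blast
    qed
  qed
  let ?W = "bracket_span br m I"
  have sW: "subspace ?W" by (simp add: bracket_span_def)
  have WI: "?W \<subseteq> I" using I_br by (intro bracket_span_subset I_subspace)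
  have hW: "br x w \<in> ?W" if "x \<in> ?h" "w \<in> ?W" for x w
    using that hm I_br by (intro bracket_span_stable) auto
  have W_nondeg: "nondegenerate_on \<omega> ?W"
    using submodule_ideal[OF sW WI hW] by (rule abelian_ideal_nondegenerate)
  \<comment> \<open>A vector of \<open>[m,I]\<close> killed by \<open>m\<close> is orthogonal to \<open>[m,I]\<close> because \<open>m\<close> acts by skew maps.\<close>
  have "?W = {0}"
  proof (rule ccontr)
    assume nz: "?W \<noteq> {0}"
    have "\<exists>w\<in>?W - {0}. \<forall>x\<in>m. br x w \<in> {0}"
    proof (rule engel[OF m_sub])
      show "\<exists>n. \<forall>y\<in>m. (br x ^^ n) y = 0" if "x \<in> m" for x
        using m_abelian that by (intro exI[of _ 1]) (simp add: lie_abelian_def)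
      show "\<exists>n. (br x ^^ n) w \<in> {0}" if "x \<in> m" "w \<in> ?W" for x w
        using nil[OF that(1)] WI that(2) by blast
      show "{0} \<subset> ?W" using nz subspace_0[OF sW] by blast
    qed (use sW hW mh in \<open>auto simp: br_simps\<close>)
    then obtain w where w: "w \<in> ?W" "w \<noteq> 0" "\<And>x. x \<in> m \<Longrightarrow> br x w = 0" by auto
    have "?W \<subseteq> {v. \<omega> w v = 0}"
    proof (rule bracket_span_subset)
      show "subspace {v. \<omega> w v = 0}" by (auto simp: subspace_def form_simps)
      fix x u assume "x \<in> m" "u \<in> I"
      then have "\<omega> (br x w) u = - \<omega> w (br x u)"
        using mh w(1) WI by (intro perp_acts_skew[OF I_abelian]) auto
      then show "br x u \<in> {v. \<omega> w v = 0}" using w(3)[OF \<open>x \<in> m\<close>] by (simp add: form_simps)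
    qed
    then have "w \<in> ?W \<inter> perp \<omega> ?W" using w(1) by (auto simp: perp_def)
    then show False using W_nondeg w(2) unfolding nondegenerate_on_def by blast
  qed
  then have "br y x = 0" if "y \<in> m" "x \<in> I" for x y using br_in_bracket_span[OF that] by simp
  then have "y = 0" if "y \<in> m" for y using perp_acts_faithfully[of y] that mh by blast
  then show False using m_ideal(2) subspace_0[OF sm] by blast
qed

text \<open>A vector \<open>e\<close> of \<open>I\<close> orthogonal to all brackets is central: for \<open>h\<close> in \<open>I\<^sup>\<bottom>\<close>, skewness makes \<open>[h,e]\<close>
orthogonal to \<open>I\<close>, and \<open>I\<close> is nondegenerate.\<close>

lemma derived_algebra_eq: "bracket_span br UNIV UNIV = I"
proof
  let ?D = "bracket_span br UNIV UNIV"
  have "br x y \<in> I" for x y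
  proof -
    obtain u h where x: "u \<in> I" "h \<in> perp \<omega> I" "x = u + h" using split by blast
    obtain u' h' where y: "u' \<in> I" "h' \<in> perp \<omega> I" "y = u' + h'" using split by blast
    have "br h h' = 0" using perp_abelian x(2) y(2) by (simp add: lie_abelian_def)
    then have "br x y = br x u' - br h' u" using br_flip[of u h'] by (simp add: x(3) y(3) br_simps)
    then show ?thesis using I_br x(1) y(1) subspace_diff[OF I_subspace] by simp
  qed
  then show DI: "?D \<subseteq> I" by (intro bracket_span_subset I_subspace)
  have sD: "subspace ?D" by (simp add: bracket_span_def)
  have D_br: "br x y \<in> ?D" for x y by (rule br_in_bracket_span) auto
  have D_nondeg: "nondegenerate_on \<omega> ?D"
    by (rule abelian_ideal_nondegenerate[OF submodule_ideal[OF sD DI D_br]])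
  show "I \<subseteq> ?D"
  proof
    fix x assume x: "x \<in> I"
    obtain d where d: "d \<in> ?D" "x - d \<in> perp \<omega> ?D" using nondegenerate_decomposition[OF sD D_nondeg] by blast
    define e where "e = x - d"
    have e: "e \<in> I" "e \<in> perp \<omega> ?D" using x d DI subspace_diff[OF I_subspace] by (auto simp: e_def)
    have "br y e = 0" for y
    proof -
      obtain u h where y: "u \<in> I" "h \<in> perp \<omega> I" "y = u + h" using split by blast
      have "\<omega> (br h e) v = 0" if "v \<in> I" for v
        using perp_acts_skew[OF I_abelian y(2) e(1) that] e(2) D_br by (simp add: perp_def)
      then have "br h e \<in> I \<inter> perp \<omega> I" using I_br[OF e(1)] by (simp add: perp_def)
      then have "br h e = 0" using I_nondegenerate unfolding nondegenerate_on_def by blast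
      moreover have "br u e = 0" using I_abelian y(1) e(1) by (simp add: lie_abelian_def)
      ultimately show ?thesis by (simp add: y(3) br_simps)
    qed
    then have "e = 0" by (rule center_trivial)
    then show "x \<in> ?D" using d(1) by (simp add: e_def)
  qed
qed

text \<open>Elements of \<open>I\<close> are sums of brackets, whose adjoint maps are traceless. For \<open>h\<close> in \<open>I\<^sup>\<bottom>\<close>, the map
\<open>ad h\<close> is \<open>\<omega>\<close>-skew on \<open>I\<close> and zero on the orthogonal complement \<open>I\<^sup>\<bottom>\<close>, hence \<open>\<omega>\<close>-skew.\<close>

lemma irreducible_unimodular: "unimodular br"
  unfolding unimodular_def
proof
  fix x
  obtain B where B: "rv.basis_of (UNIV :: 'a set) B" using basis_exists[OF subspace_UNIV] by blast
  have stab: "stabilizes UNIV x" for x by (simp add: stabilizes_def)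
  have id: "rv.endo_on UNIV (\<lambda>v. v)" by (simp add: rv.endo_on_def)
  obtain u h where x: "u \<in> I" "h \<in> perp \<omega> I" "x = u + h" using split by blast
  have skew_h: "\<omega> (br h y) z = - \<omega> y (br h z)" for y z
  proof -
    obtain u h' where y: "u \<in> I" "h' \<in> perp \<omega> I" "y = u + h'" using split by blast
    obtain v h'' where z: "v \<in> I" "h'' \<in> perp \<omega> I" "z = v + h''" using split by blast
    have "br h h' = 0" "br h h'' = 0" using perp_abelian x(2) y(2) z(2) by (auto simp: lie_abelian_def)
    moreover have "\<omega> (br h u) h'' = 0" using perp_flip[OF z(2)] I_br[OF y(1)] by blast
    moreover have "\<omega> h' (br h v) = 0" using y(2) I_br[OF z(1)] by (simp add: perp_def)
    moreover have "\<omega> (br h u) v = - \<omega> u (br h v)" by (rule perp_acts_skew[OF I_abelian x(2) y(1) z(1)])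
    ultimately show ?thesis by (simp add: y(3) z(3) br_simps form_simps)
  qed
  have "linear (br h)" using bilinear_br by (simp add: bilinear_def)
  then have "lin_trace (br h) = 0" using skew_h by (rule trace_skew_zero)
  moreover have "lin_trace (br u) = 0"
    using x(1) derived_algebra_eq by (intro lin_trace_br_commutators) simp
  ultimately show "lin_trace (br x) = 0"
    using trace_br_lincomb[OF B id stab stab, of 1 u h] by (simp add: lin_trace_br_eq x(3))
qed

end

theorem irreducible_structure:
  defines "D \<equiv> bracket_span br UNIV UNIV" and "A \<equiv> perp \<omega> (bracket_span br UNIV UNIV)"
  shows "maximal_abelian_ideal br D" "nondegenerate_on \<omega> D" "lie_subalgebra br A" "lie_abelian br A"
    "nondegenerate_on \<omega> A" "unimodular br" "is_direct_sum UNIV D A"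
    "\<And>h. h \<in> A \<Longrightarrow> (\<And>x. x \<in> D \<Longrightarrow> br h x = 0) \<Longrightarrow> h = 0"
proof -
  obtain I where I: "maximal_abelian_ideal br I" using maximal_abelian_ideal_exists by blast
  have D: "D = I" and A: "A = perp \<omega> I" using derived_algebra_eq[OF I] by (auto simp: D_def A_def)
  have ideal: "lie_ideal br I" and abelian: "lie_abelian br I" using I by (auto simp: maximal_abelian_ideal_def)
  have nondeg: "nondegenerate_on \<omega> I" by (rule abelian_ideal_nondegenerate[OF ideal abelian])
  have sub: "subspace I" using ideal by (simp add: lie_ideal_def)
  show "maximal_abelian_ideal br D" "nondegenerate_on \<omega> D" using I nondeg by (simp_all add: D)
  show "lie_subalgebra br A" using perp_ideal_subalgebra[OF ideal] by (simp add: A)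
  show "lie_abelian br A" using perp_abelian[OF I] by (simp add: A)
  show "nondegenerate_on \<omega> A" using nondegenerate_perp[OF sub nondeg] by (simp add: A)
  show "unimodular br" by (rule irreducible_unimodular[OF I])
  show "h = 0" if "h \<in> A" "\<And>x. x \<in> D \<Longrightarrow> br h x = 0" for h
    using perp_acts_faithfully[OF I] that by (simp add: A D)
  have "\<exists>u v. x = u + v \<and> u \<in> I \<and> v \<in> perp \<omega> I" for x
    using nondegenerate_decomposition[OF sub nondeg, of x] by (metis add.commute diff_add_cancel)
  then show "is_direct_sum UNIV D A"
    using sub subspace_perp nondeg unfolding is_direct_sum_def D A nondegenerate_on_def by blast
qed

end

theorem theorem6p2:
  fixes br :: "'a::real_vector \<Rightarrow> 'a \<Rightarrow> 'a"
    and \<omega> :: "'a \<Rightarrow> 'a \<Rightarrow> real"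
  assumes "symplectic_lie_algebra br \<omega>"
    and "(UNIV :: 'a set) \<noteq> {0}"
    and "symplectically_irreducible br \<omega>"
  shows "let D = bracket_span br UNIV UNIV; A = perp \<omega> D; \<pi> = (\<lambda>a x. br a x) in
      bracket_span br D D = {0} \<and>
      (is_direct_sum UNIV D A \<and>
       lie_ideal br D \<and> lie_abelian br D \<and> nondegenerate_on \<omega> D \<and>
       lie_subalgebra br A \<and> lie_abelian br A \<and> nondegenerate_on \<omega> A \<and>
       unimodular br) \<and>
      maximal_abelian_ideal br D \<and>
      (lie_representation br A D \<pi> \<and> faithful_on A D \<pi> \<and>
       (\<forall>a\<in>A. \<forall>x\<in>D. \<forall>y\<in>D. \<omega> (\<pi> a x) y = - \<omega> x (\<pi> a y)))"
proof -
  interpret irreducible_symplectic_lie_algebra br \<omega>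
    using assms(1,3)
    by (simp add: irreducible_symplectic_lie_algebra_def irreducible_symplectic_lie_algebra_axioms_def)
  define D where "D = bracket_span br UNIV UNIV"
  define A where "A = perp \<omega> D"
  note str = irreducible_structure[folded D_def, folded A_def]
  have ideal: "lie_ideal br D" and abelian: "lie_abelian br D"
    using str(1) by (auto simp: maximal_abelian_ideal_def)
  have D: "subspace D" "\<And>x y. y \<in> D \<Longrightarrow> br x y \<in> D" using ideal by (auto simp: lie_ideal_def)
  have sA: "subspace A" using str(3) by (simp add: lie_subalgebra_def)
  have "bracket_span br D D \<subseteq> {0}"
    using abelian by (intro bracket_span_subset) (auto simp: lie_abelian_def)
  then have derived: "bracket_span br D D = {0}" by (auto simp: bracket_span_def span_zero)
  have rep: "lie_representation br A D br"
    using str(3) D by (simp add: lie_representation_def br_simps br_br_left)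
  have faithful: "faithful_on A D br"
    unfolding faithful_on_def
  proof (rule inj_onI)
    fix a b assume ab: "a \<in> A" "b \<in> A" and eq: "restrict (br a) D = restrict (br b) D"
    have "br (a - b) x = 0" if "x \<in> D" for x
      using fun_cong[OF eq, of x] that by (simp add: br_simps)
    moreover have "a - b \<in> A" using ab subspace_diff[OF sA] by blast
    ultimately have "a - b = 0" using str(8) by blast
    then show "a = b" by simp
  qed
  have skew: "\<forall>a\<in>A. \<forall>x\<in>D. \<forall>y\<in>D. \<omega> (br a x) y = - \<omega> x (br a y)"
    using perp_acts_skew[OF abelian] by (simp add: A_def)
  show ?thesis
    unfolding Let_def D_def[symmetric] A_def[symmetric]
    using str(1-7) ideal abelian derived rep faithful skew by simp
qed

end
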